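(* Let $p,s\in\mathbb{N}\setminus\{1\}$ with $p\le s$. Suppose $E$ is a uniformly complete vector lattice, $Y$ is a convex bornological space, and $P\colon E\to Y$ is a bounded $s$-homogeneous polynomial with associated symmetric $s$-linear map $\check{P}\colon E^s\to Y$. Let $\gamma_{r_1/s,\dots,r_p/s}$ be a completely partitioned weighted geometric mean. Then $P$ is orthogonally additive if and only if \[ P\bigl(\gamma_{r_1/s,\dots,r_p/s}(f_1,\dots,f_p)\bigr)=\check{P}(\underbrace{f_1,\dots,f_1}_{r_1\ \text{copies}},\underbrace{f_2,\dots,f_2}_{r_2\ \text{copies}},\dots,\underbrace{f_p,\dots,f_p}_{r_p\ \text{copies}}) \] holds for every $f_1,\dots,f_p\in E_+$.
   Context: All vector spaces are real and all vector lattices are Archimedean; $\mathbb{N}=\{1,2,\dots\}$; $E_+$ is the positive cone of $E$. Uniformly complete means relatively uniformly complete (every relatively uniformly Cauchy sequence converges relatively uniformly). The terms "convex bornological space" and "bounded" are used in their usual sense. A convex bornological space is a vector space $Y$ with a collection of subsets (the bounded sets) that covers $Y$ and is closed under taking subsets, finite unions, sums, scalar multiples, balanced hulls and convex hulls. A map $P\colon E\to Y$ is bounded if it maps order bounded subsets of $E$ to bounded subsets of $Y$. A map $P\colon E\to V$ into a vector space $V$ is an $s$-homogeneous polynomial if there is a (unique) symmetric $s$-linear map $\check{P}\colon E^s\to V$ with $P(f)=\check{P}(f,\dots,f)$ for all $f\in E$. It is orthogonally additive if $P(f+g)=P(f)+P(g)$ whenever $f,g\in E$ are disjoint (i.e.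 $|f|\wedge|g|=0$). Complete partition: $(r_1,\dots,r_p)$ is a complete partition of $s$ if (i) $r_1,\dots,r_p\in\mathbb{N}$; (ii) $\sum_{k=1}^p r_k=s$; (iii) for every $q\in\{1,\dots,s\}$ there exist $\alpha_1,\dots,\alpha_p\in\{0,1\}$ with $q=\sum_{k=1}^p\alpha_kr_k$. Weighted geometric mean: for $t_1,\dots,t_p\in(0,1)$ with $\sum_{k=1}^pt_k=1$ and $x_1,\dots,x_p\in\mathbb{R}$, $\gamma_{t_1,\dots,t_p}(x_1,\dots,x_p)=\prod_{k=1}^p|x_k|^{t_k}$. A completely partitioned weighted geometric mean is one of the form $\gamma_{r_1/s,\dots,r_p/s}$ with $(r_1,\dots,r_p)$ a complete partition of $s$. This function is continuous and positively homogeneous, so $\gamma_{r_1/s,\dots,r_p/s}(f_1,\dots,f_p)\in E$ is defined for $f_1,\dots,f_p\in E$ by the Archimedean vector lattice functional calculus. For $f_1,\dots,f_p\in E_+$ it is given explicitly by \[ \gamma_{r_1/s,\dots,r_p/s}(f_1,\dots,f_p)=\frac{1}{s}\inf\Bigl\{\sum_{k=1}^{p}r_k\theta_kf_k:\theta_k\in(0,\infty),\ \prod_{k=1}^{p}\theta_k^{r_k/s}=1\Bigr\}. \]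
   Formalization: The convex bornological space Y is additionally assumed separated (its only bounded linear subspace is {0}); without this the equivalence fails, e.g. for Y = ℝ with all subsets bounded. *)

theory Defs
  imports "HOL-Analysis.Analysis" "HOL-Library.Lattice_Algebras"
begin

section \<open>Uniformly complete Archimedean vector lattices\<close>

class archimedean_vector_lattice = ordered_real_vector + lattice_ab_group_add_abs +
  assumes archimedean: "(\<And>n::nat. real n *\<^sub>R x \<le> y) \<Longrightarrow> x \<le> 0"
begin

definition relatively_uniformly_Cauchy :: "(nat \<Rightarrow> 'a) \<Rightarrow> bool" where
  "relatively_uniformly_Cauchy X \<longleftrightarrow>
    (\<exists>u\<ge>0. \<forall>\<epsilon>::real. \<epsilon> > 0 \<longrightarrow> (\<exists>N. \<forall>m\<ge>N. \<forall>n\<ge>N. \<bar>X m - X n\<bar> \<le> \<epsilon> *\<^sub>R u))"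

definition relatively_uniformly_tendsto :: "(nat \<Rightarrow> 'a) \<Rightarrow> 'a \<Rightarrow> bool" where
  "relatively_uniformly_tendsto X x \<longleftrightarrow>
    (\<exists>u\<ge>0. \<forall>\<epsilon>::real. \<epsilon> > 0 \<longrightarrow> (\<exists>N. \<forall>n\<ge>N. \<bar>X n - x\<bar> \<le> \<epsilon> *\<^sub>R u))"

end

class uniformly_complete_vector_lattice = archimedean_vector_lattice +
  assumes relatively_uniformly_Cauchy_converges:
    "relatively_uniformly_Cauchy X \<Longrightarrow> \<exists>x. relatively_uniformly_tendsto X x"


section \<open>Archimedean vector lattice functional calculus\<close>

definition vector_sublattice :: "'a::archimedean_vector_lattice set \<Rightarrow> bool" where
  "vector_sublattice L \<longleftrightarrow>
    subspace L \<and> (\<forall>x\<in>L. \<forall>y\<in>L. sup x y \<in> L \<and> inf x y \<in> L)"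

definition real_lattice_hom_on :: "'a::archimedean_vector_lattice set \<Rightarrow> ('a \<Rightarrow> real) \<Rightarrow> bool" where
  "real_lattice_hom_on L \<omega> \<longleftrightarrow>
    (\<forall>x\<in>L. \<forall>y\<in>L. \<omega> (x + y) = \<omega> x + \<omega> y) \<and>
    (\<forall>c. \<forall>x\<in>L. \<omega> (c *\<^sub>R x) = c * \<omega> x) \<and>
    (\<forall>x\<in>L. \<forall>y\<in>L. \<omega> (sup x y) = max (\<omega> x) (\<omega> y) \<and> \<omega> (inf x y) = min (\<omega> x) (\<omega> y))"

text \<open>
  The functional calculus of Buskes, de Pagter and van Rooij: for a continuous positively
  homogeneous function \<open>h\<close> on tuples of reals, \<open>h(f\<^sub>1,\<dots>,f\<^sub>p)\<close> is the element \<open>g\<close> with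
  \<open>\<omega>(g) = h(\<omega>(f\<^sub>1),\<dots>,\<omega>(f\<^sub>p))\<close> for every real lattice homomorphism \<open>\<omega>\<close> on the vector sublattice
  generated by \<open>f\<^sub>1,\<dots>,f\<^sub>p,g\<close>.  (Homomorphisms on all of \<open>E\<close> would not do: there may be none
  but zero.)  Tuples are lists.
\<close>

definition functional_calculus_value ::
    "(real list \<Rightarrow> real) \<Rightarrow> 'a::archimedean_vector_lattice list \<Rightarrow> 'a \<Rightarrow> bool" where
  "functional_calculus_value h fs g \<longleftrightarrow>
    (\<forall>\<omega>. real_lattice_hom_on (vector_sublattice hull (insert g (set fs))) \<omega>
          \<longrightarrow> \<omega> g = h (map \<omega> fs))"

definition functional_calculus ::
    "(real list \<Rightarrow> real) \<Rightarrow> 'a::archimedean_vector_lattice list \<Rightarrow> 'a" where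
  "functional_calculus h fs = (THE g. functional_calculus_value h fs g)"


section \<open>Completely partitioned weighted geometric means\<close>

definition complete_partition :: "nat \<Rightarrow> nat list \<Rightarrow> bool" where
  "complete_partition s r \<longleftrightarrow>
    (\<forall>k<length r. r ! k \<ge> 1) \<and>
    (\<Sum>k<length r. r ! k) = s \<and>
    (\<forall>q\<in>{1..s}. \<exists>\<alpha>. (\<forall>k<length r. \<alpha> k \<in> {0, 1}) \<and> q = (\<Sum>k<length r. \<alpha> k * r ! k))"

definition weighted_geometric_mean :: "real list \<Rightarrow> real list \<Rightarrow> real" where
  "weighted_geometric_mean t x = (\<Prod>k<length t. \<bar>x ! k\<bar> powr (t ! k))"

definition partitioned_geometric_mean ::
    "nat \<Rightarrow> nat list \<Rightarrow> 'a::archimedean_vector_lattice list \<Rightarrow> 'a" where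
  "partitioned_geometric_mean s r =
    functional_calculus (weighted_geometric_mean (map (\<lambda>k. real k / real s) r))"


section \<open>Homogeneous polynomials\<close>

text \<open>The \<open>s\<close>-fold power of the domain is represented by lists of length \<open>s\<close>.\<close>

definition symmetric_multilinear ::
    "nat \<Rightarrow> ('a::real_vector list \<Rightarrow> 'b::real_vector) \<Rightarrow> bool" where
  "symmetric_multilinear s T \<longleftrightarrow>
    (\<forall>xs. length xs = s \<longrightarrow> (\<forall>i<s. linear (\<lambda>x. T (xs[i := x])))) \<and>
    (\<forall>xs ys. length xs = s \<and> mset xs = mset ys \<longrightarrow> T xs = T ys)"

definition homogeneous_polynomial_with ::
    "nat \<Rightarrow> ('a::real_vector \<Rightarrow> 'b::real_vector) \<Rightarrow> ('a list \<Rightarrow> 'b) \<Rightarrow> bool" where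
  "homogeneous_polynomial_with s P T \<longleftrightarrow>
    symmetric_multilinear s T \<and> (\<forall>f. P f = T (replicate s f))"

definition orthogonally_additive ::
    "('a::archimedean_vector_lattice \<Rightarrow> 'b::real_vector) \<Rightarrow> bool" where
  "orthogonally_additive P \<longleftrightarrow>
    (\<forall>f g. inf \<bar>f\<bar> \<bar>g\<bar> = 0 \<longrightarrow> P (f + g) = P f + P g)"


section \<open>Convex bornological spaces\<close>

definition convex_bornology :: "'b::real_vector set set \<Rightarrow> bool" where
  "convex_bornology \<B> \<longleftrightarrow>
    \<Union>\<B> = UNIV \<and>
    (\<forall>A\<in>\<B>. \<forall>A'. A' \<subseteq> A \<longrightarrow> A' \<in> \<B>) \<and>
    (\<forall>A\<in>\<B>. \<forall>A'\<in>\<B>. A \<union> A' \<in> \<B>) \<and>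
    (\<forall>A\<in>\<B>. \<forall>A'\<in>\<B>. {x + y | x y. x \<in> A \<and> y \<in> A'} \<in> \<B>) \<and>
    (\<forall>A\<in>\<B>. \<forall>c::real. {c *\<^sub>R x | x. x \<in> A} \<in> \<B>) \<and>
    (\<forall>A\<in>\<B>. {c *\<^sub>R x | c x. \<bar>c::real\<bar> \<le> 1 \<and> x \<in> A} \<in> \<B>) \<and>
    (\<forall>A\<in>\<B>. convex hull A \<in> \<B>)"

text \<open>
  A bornology is separated if no nonzero subspace is bounded.  Without this standing convention
  every subset of the codomain could be bounded, and boundedness of a map would say nothing.
\<close>

definition separated_bornology :: "'b::real_vector set set \<Rightarrow> bool" where
  "separated_bornology \<B> \<longleftrightarrow> (\<forall>V\<in>\<B>. subspace V \<longrightarrow> V = {0})"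

definition bounded_map ::
    "('a::archimedean_vector_lattice \<Rightarrow> 'b::real_vector) \<Rightarrow> 'b set set \<Rightarrow> bool" where
  "bounded_map P \<B> \<longleftrightarrow> (\<forall>A. (\<exists>a b. A \<subseteq> {a..b}) \<longrightarrow> P ` A \<in> \<B>)"

end

theory Submission
  imports Defs "HOL-Computational_Algebra.Polynomial"
begin

text \<open>
  Everything happens in the ideal \<open>A\<close> generated by a positive element \<open>e\<close>.  Zorn's lemma yields enough
  real lattice homomorphisms \<open>\<omega>\<close> on \<open>A\<close> with \<open>\<omega> e = 1\<close> to decide order and equality, and uniform
  completeness then makes \<open>A\<close> closed under composition with continuous functions, hence under
  pointwise products and roots.  If \<open>P\<close> is orthogonally additive, polarization shows that \<open>T\<close> vanishes
  on lists that split into two nonempty mutually disjoint parts; partitions of unity and boundedness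
  improve this to \<open>T(x,y,\<dots>) = 0\<close> for disjoint \<open>x, y\<close> and further to \<open>T(u,v,\<dots>) = T(e,uv,\<dots>)\<close>.
  Thus \<open>T\<close> depends only on the product of its arguments, and \<open>T(f\<^sub>1,\<dots>,f\<^sub>p)\<close> with multiplicities \<open>r\<^sub>k\<close>
  equals \<open>P\<close> of the \<open>s\<close>-th root of that product.  Conversely, by completeness of the partition every
  \<open>T(f,\<dots>,f,g,\<dots>,g)\<close> with \<open>f, g \<ge> 0\<close> disjoint is \<open>P\<close> of a geometric mean, and that mean is \<open>0\<close>.
\<close>

section \<open>Polarization\<close>

text \<open>Two features of the setting shape the argument. The codomain carries only a bornology,
  so no limit can be taken there: an approximation step instead shows that all multiples
  \<open>n v\<close> of an error \<open>v\<close> lie in one bounded set chosen before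
  \<open>n\<close>, and separatedness then gives \<open>v = 0\<close>. Moreover, boundedness of
  \<open>P\<close> controls \<open>T\<close> only on the diagonal. Interpolation at finitely many
  points carries the bound over to arbitrary lists, and the same computation with "bounded" read as
  "zero" carries over vanishing. On the domain side, the functional calculus tests an element
  against homomorphisms of a small generated sublattice, whereas products and roots are built in the
  larger ideal of \<open>e\<close>; homomorphisms therefore have to be restricted to the sublattice
  and extended from it. The product depends on the choice of \<open>e\<close>, which is its unit:
  this is why exchanging \<open>u, v\<close> for \<open>e, uv\<close> does not change the product of
  all arguments.\<close>

lemma interpolation_weights:
  "\<exists>w::nat \<Rightarrow> real. \<forall>i\<le>n. (\<Sum>j\<le>n. w j * real j ^ i) = (if i = k then 1 else 0)"
proof -
  \<comment> \<open>Lagrange basis polynomials for the nodes \<open>0, ..., n\<close>. Comparing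
    coefficients of degree \<open>k\<close> in \<open>X^i = sum_j j^i L_j\<close> shows that their
    \<open>k\<close>-th coefficients are the required weights.\<close>
  define L :: "nat \<Rightarrow> real poly"
    where "L j = (\<Prod>m\<in>{..n}-{j}. smult (1 / (real j - real m)) [:- real m, 1:])" for j
  have deg_L: "degree (L j) \<le> n" if "j \<le> n" for j
  proof -
    have "degree (L j) \<le> sum (degree \<circ> (\<lambda>m. smult (1 / (real j - real m)) [:- real m, 1:])) ({..n}-{j})"
      unfolding L_def by (rule degree_prod_sum_le) simp
    also have "\<dots> \<le> (\<Sum>m\<in>{..n}-{j}. 1)"
      by (rule sum_mono) (auto intro: order_trans[OF degree_smult_le])
    also have "\<dots> = n" using that by simp
    finally show ?thesis .
  qed
  have poly_L: "poly (L j) (real l) = (if l = j then 1 else 0)" if "j \<le> n" "l \<le> n" for j l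
  proof (cases "l = j")
    case True
    then show ?thesis unfolding L_def poly_prod
      by (auto intro!: prod.neutral simp: diff_divide_distrib[symmetric])
  next
    case False
    have "(\<Prod>m\<in>{..n}-{j}. poly (smult (1 / (real j - real m)) [:- real m, 1:]) (real l)) = 0"
      by (rule prod_zero) (use False that in auto)
    then show ?thesis using False unfolding L_def poly_prod by simp
  qed
  have "(\<Sum>j\<le>n. smult (real j ^ i) (L j)) = monom 1 i" if i: "i \<le> n" for i
  proof (rule poly_eqI_degree[where A = "real ` {..n}"])
    fix x assume "x \<in> real ` {..n}"
    then obtain l where l: "x = real l" "l \<le> n" by auto
    have "poly (\<Sum>j\<le>n. smult (real j ^ i) (L j)) x
        = (\<Sum>j\<le>n. if l = j then real j ^ i else 0)"
      unfolding poly_sum by (rule sum.cong) (use l in \<open>auto simp: poly_L\<close>)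
    also have "\<dots> = real l ^ i" using l by (simp add: sum.delta)
    finally show "poly (\<Sum>j\<le>n. smult (real j ^ i) (L j)) x = poly (monom 1 i) x"
      by (simp add: l poly_monom)
  next
    have c: "card (real ` {..n}) = Suc n" by (subst card_image) auto
    have "degree (\<Sum>j\<le>n. smult (real j ^ i) (L j)) \<le> n"
      by (rule degree_sum_le) (auto intro: order_trans[OF degree_smult_le] deg_L)
    then show "degree (\<Sum>j\<le>n. smult (real j ^ i) (L j)) < card (real ` {..n})" using c by simp
    show "degree (monom (1::real) i) < card (real ` {..n})" using c i by (simp add: degree_monom_eq)
  qed
  then have "(\<Sum>j\<le>n. coeff (L j) k * real j ^ i) = (if i = k then 1 else 0)" if "i \<le> n" for i
  proof -
    have "coeff (\<Sum>j\<le>n. smult (real j ^ i) (L j)) k = (if i = k then 1 else 0)"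
      using \<open>\<And>i. i \<le> n \<Longrightarrow> (\<Sum>j\<le>n. smult (real j ^ i) (L j)) = monom 1 i\<close>[OF that] by simp
    then show ?thesis by (simp add: coeff_sum mult.commute)
  qed
  then show ?thesis by (intro exI[of _ "\<lambda>j. coeff (L j) k"] allI impI)
qed

text \<open>The weights do not depend on the coefficients \<open>c\<close>. Hence bounded values at
  the nodes give bounded coefficients and vanishing values give vanishing ones. All nodes are
  nonnegative, so that the method also works on cones.\<close>

lemma coefficient_extraction:
  obtains w :: "nat \<Rightarrow> real"
  where "\<And>c :: nat \<Rightarrow> 'v::real_vector.
    (\<Sum>j\<le>n. w j *\<^sub>R (\<Sum>i\<le>n. real j ^ i *\<^sub>R c i)) = (if k \<le> n then c k else 0)"
proof -
  obtain w where w: "\<forall>i\<le>n. (\<Sum>j\<le>n. w j * real j ^ i) = (if i = k then 1 else 0)"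
    using interpolation_weights by metis
  have "(\<Sum>j\<le>n. w j *\<^sub>R (\<Sum>i\<le>n. real j ^ i *\<^sub>R c i)) = (if k \<le> n then c k else 0)"
    for c :: "nat \<Rightarrow> 'v"
  proof -
    have "(\<Sum>j\<le>n. w j *\<^sub>R (\<Sum>i\<le>n. real j ^ i *\<^sub>R c i))
        = (\<Sum>i\<le>n. \<Sum>j\<le>n. (w j * real j ^ i) *\<^sub>R c i)"
      unfolding scaleR_sum_right by (subst sum.swap) simp
    also have "\<dots> = (\<Sum>i\<le>n. (if i = k then 1 else 0) *\<^sub>R c i)"
      by (rule sum.cong) (use w in \<open>auto simp flip: scaleR_sum_left\<close>)
    also have "\<dots> = (\<Sum>i\<le>n. if i = k then c i else 0)"
      by (rule sum.cong) auto
    also have "\<dots> = (if k \<le> n then c k else 0)" by (simp add: sum.delta)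
    finally show ?thesis .
  qed
  then show ?thesis using that by blast
qed

lemma vector_polynomial_zero:
  fixes c :: "nat \<Rightarrow> 'v::real_vector"
  assumes "\<And>j::nat. (\<Sum>i\<le>n. real j ^ i *\<^sub>R c i) = 0" and "k \<le> n"
  shows "c k = 0"
proof -
  obtain w where "\<And>c :: nat \<Rightarrow> 'v.
    (\<Sum>j\<le>n. w j *\<^sub>R (\<Sum>i\<le>n. real j ^ i *\<^sub>R c i)) = (if k \<le> n then c k else 0)"
    using coefficient_extraction by blast
  from this[of c] show ?thesis using assms by simp
qed

section \<open>Expansion and polarization of symmetric multilinear maps\<close>

lemma symmetric_multilinear_mset:
  assumes "symmetric_multilinear s T" "length xs = s" "mset xs = mset ys"
  shows "T xs = T ys"
  using assms unfolding symmetric_multilinear_def by blast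

lemma symmetric_multilinear_linear:
  assumes "symmetric_multilinear s T" "length xs + length ys + 1 = s"
  shows "linear (\<lambda>x. T (xs @ x # ys))"
proof -
  have "linear (\<lambda>x. T ((xs @ undefined # ys)[length xs := x]))"
    using assms(1)[unfolded symmetric_multilinear_def, THEN conjunct1,
        rule_format, of "xs @ undefined # ys" "length xs"] assms(2) by simp
  then show ?thesis by simp
qed

text \<open>The spectators \<open>zs\<close> give the induction a place to which an expanded
  argument can be moved; polarization needs them as well, for the entries that are already
  free.\<close>

lemma symmetric_multilinear_binomial:
  fixes T :: "'a::real_vector list \<Rightarrow> 'b::real_vector"
  assumes T: "symmetric_multilinear s T" and "k + length zs = s"
  shows "T (replicate k (x + t *\<^sub>R y) @ zs)
    = (\<Sum>i\<le>k. t ^ i *\<^sub>R real (k choose i) *\<^sub>R T (replicate (k - i) x @ replicate i y @ zs))"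
  using assms(2)
proof (induction k arbitrary: zs)
  case 0
  then show ?case by simp
next
  case (Suc k)
  let ?u = "x + t *\<^sub>R y"
  let ?R = "\<lambda>i. T (replicate (Suc k - i) x @ replicate i y @ zs)"
  interpret l: linear "\<lambda>v. T (replicate k ?u @ v # zs)"
    by (rule symmetric_multilinear_linear[OF T]) (use Suc.prems in simp)
  have swap: "replicate (Suc k) ?u @ zs = replicate k ?u @ ?u # zs"
    by (simp add: replicate_append_same[symmetric])
  have x: "T (replicate (k - i) x @ replicate i y @ x # zs) = ?R i" if "i \<le> k" for i
    by (rule symmetric_multilinear_mset[OF T]) (use Suc.prems that in \<open>auto simp: Suc_diff_le\<close>)
  have y: "T (replicate (k - i) x @ replicate i y @ y # zs) = ?R (Suc i)" if "i \<le> k" for i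
    by (rule symmetric_multilinear_mset[OF T]) (use Suc.prems that in auto)
  have "T (replicate (Suc k) ?u @ zs) = T (replicate k ?u @ x # zs) + t *\<^sub>R T (replicate k ?u @ y # zs)"
    unfolding swap l.add l.scale ..
  also have "T (replicate k ?u @ x # zs) = (\<Sum>i\<le>k. t ^ i *\<^sub>R real (k choose i) *\<^sub>R ?R i)"
    by (subst Suc.IH) (use Suc.prems in \<open>auto simp: x intro!: sum.cong\<close>)
  also have "\<dots> = (\<Sum>i\<le>Suc k. t ^ i *\<^sub>R real (k choose i) *\<^sub>R ?R i)" by simp
  also have "\<dots> = ?R 0 + (\<Sum>i\<le>k. t ^ Suc i *\<^sub>R real (k choose Suc i) *\<^sub>R ?R (Suc i))"
    by (subst sum.atMost_Suc_shift) simp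
  also have "t *\<^sub>R T (replicate k ?u @ y # zs) = (\<Sum>i\<le>k. t ^ Suc i *\<^sub>R real (k choose i) *\<^sub>R ?R (Suc i))"
    by (subst Suc.IH) (use Suc.prems in \<open>auto simp: y scaleR_sum_right intro!: sum.cong\<close>)
  also have "?R 0 + (\<Sum>i\<le>k. t ^ Suc i *\<^sub>R real (k choose Suc i) *\<^sub>R ?R (Suc i)) +
      (\<Sum>i\<le>k. t ^ Suc i *\<^sub>R real (k choose i) *\<^sub>R ?R (Suc i))
      = ?R 0 + (\<Sum>i\<le>k. t ^ Suc i *\<^sub>R real (Suc k choose Suc i) *\<^sub>R ?R (Suc i))"
    by (simp add: sum.distrib[symmetric] scaleR_add_left[symmetric] scaleR_add_right[symmetric]
        add.commute distrib_left)
  also have "\<dots> = (\<Sum>i\<le>Suc k. t ^ i *\<^sub>R real (Suc k choose i) *\<^sub>R ?R i)"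
    by (simp only: sum.atMost_Suc_shift) simp
  finally show ?case .
qed

text \<open>Besides bornologies this covers \<open>{{}, {0}}\<close>, for which boundedness means vanishing.\<close>

definition set_ideal :: "'b::real_vector set set \<Rightarrow> bool" where
  "set_ideal \<B> \<longleftrightarrow> {0} \<in> \<B> \<and> (\<forall>A\<in>\<B>. \<forall>A'. A' \<subseteq> A \<longrightarrow> A' \<in> \<B>) \<and>
    (\<forall>A\<in>\<B>. \<forall>A'\<in>\<B>. {x + y | x y. x \<in> A \<and> y \<in> A'} \<in> \<B>) \<and>
    (\<forall>A\<in>\<B>. \<forall>c::real. {c *\<^sub>R x | x. x \<in> A} \<in> \<B>)"

lemma set_ideal_bornology: "convex_bornology \<B> \<Longrightarrow> set_ideal \<B>"
proof -
  assume b: "convex_bornology \<B>"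
  then have "0 \<in> \<Union>\<B>" unfolding convex_bornology_def by simp
  then obtain B where B: "B \<in> \<B>" "{0} \<subseteq> B" by auto
  have "\<forall>A\<in>\<B>. \<forall>A'. A' \<subseteq> A \<longrightarrow> A' \<in> \<B>" using b unfolding convex_bornology_def by (elim conjE)
  then have "{0} \<in> \<B>" using B by blast
  then show ?thesis using b unfolding convex_bornology_def set_ideal_def by (elim conjE) (intro conjI)
qed

lemma set_ideal_zero: "set_ideal (Pow {0})"
  unfolding set_ideal_def by (auto simp: subset_singleton_iff)

lemma set_idealD:
  assumes "set_ideal \<B>"
  shows "A \<in> \<B> \<Longrightarrow> A' \<subseteq> A \<Longrightarrow> A' \<in> \<B>"
    and "A \<in> \<B> \<Longrightarrow> A' \<in> \<B> \<Longrightarrow> {x + y | x y. x \<in> A \<and> y \<in> A'} \<in> \<B>"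
    and "A \<in> \<B> \<Longrightarrow> {c *\<^sub>R x | x. x \<in> A} \<in> \<B>"
  using assms unfolding set_ideal_def by (elim conjE, blast)+

lemma set_ideal_combination:
  assumes "set_ideal \<B>" and "\<And>j. j \<le> (n::nat) \<Longrightarrow> B j \<in> \<B>"
  shows "{\<Sum>j\<le>n. w j *\<^sub>R b j | b. \<forall>j\<le>n. b j \<in> B j} \<in> \<B>"
  using assms(2)
proof (induction n)
  case 0
  have "{w 0 *\<^sub>R x | x. x \<in> B 0} \<in> \<B>" using 0 set_idealD(3)[OF assms(1)] by blast
  then show ?case by (rule set_idealD(1)[OF assms(1)]) auto
next
  case (Suc n)
  have 1: "{\<Sum>j\<le>n. w j *\<^sub>R b j | b. \<forall>j\<le>n. b j \<in> B j} \<in> \<B>" using Suc by simp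
  have 2: "{w (Suc n) *\<^sub>R x | x. x \<in> B (Suc n)} \<in> \<B>"
    using Suc.prems set_idealD(3)[OF assms(1)] by blast
  show ?case
    by (rule set_idealD(1)[OF assms(1) set_idealD(2)[OF assms(1) 1 2]]) fastforce
qed

text \<open>Entries are freed from the diagonal one at a time. A value with \<open>k\<close> copies
  of \<open>x\<close> and one \<open>y\<close> is, up to the factor \<open>k + 1\<close>, the
  coefficient of \<open>t\<close> in \<open>T\<close> at \<open>k + 1\<close> copies of
  \<open>x + t y\<close>, hence a fixed combination of the values at
  \<open>t = 0, 1, ..., k + 1\<close>. The points \<open>x + j y\<close> leave the original domain,
  which is why \<open>U\<close> carries a radius: order intervals grow with it, while cones and
  subspaces are constant families.\<close>

lemma polarization:
  fixes T :: "'a::real_vector list \<Rightarrow> 'b::real_vector" and U :: "real \<Rightarrow> 'a set"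
  assumes T: "symmetric_multilinear s T" and I: "set_ideal \<B>"
    and U: "\<And>a b x y t. x \<in> U a \<Longrightarrow> y \<in> U b \<Longrightarrow> 0 \<le> a \<Longrightarrow> 0 \<le> b \<Longrightarrow> 0 \<le> t \<Longrightarrow>
      x + t *\<^sub>R y \<in> U (a + t * b)"
    and U_mono: "\<And>a b. 0 \<le> a \<Longrightarrow> a \<le> b \<Longrightarrow> U a \<subseteq> U b"
    and n: "n + length zs = s"
    and diag: "\<And>c. 0 \<le> c \<Longrightarrow> {T (replicate n x @ zs) | x. x \<in> U c} \<in> \<B>"
    and c: "0 \<le> c" and ne: "U c \<noteq> {}"
  shows "{T (xs @ zs) | xs. set xs \<subseteq> U c \<and> length xs = n} \<in> \<B>"
proof -
  define D where "D k m c = {T (replicate k x @ ys @ zs) | x ys. x \<in> U c \<and> set ys \<subseteq> U c \<and> length ys = m}"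
    for k m c
  have "D k m c \<in> \<B>" if "k + m = n" "0 \<le> c" for k m c
    using that
  proof (induction m arbitrary: k c)
    case 0
    then show ?case using diag[of c] by (simp add: D_def)
  next
    case (Suc m)
    obtain w where w: "\<And>c :: nat \<Rightarrow> 'b.
      (\<Sum>j\<le>Suc k. w j *\<^sub>R (\<Sum>i\<le>Suc k. real j ^ i *\<^sub>R c i)) = (if 1 \<le> Suc k then c 1 else 0)"
      using coefficient_extraction[of "Suc k" 1] by blast
    let ?B = "\<lambda>j::nat. D (Suc k) m (c + real j * c)"
    have comb: "{\<Sum>j\<le>Suc k. w j *\<^sub>R b j | b. \<forall>j\<le>Suc k. b j \<in> ?B j} \<in> \<B>"
      by (rule set_ideal_combination[OF I]) (use Suc in auto)
    have "D k (Suc m) c \<subseteq> {inverse (real (Suc k)) *\<^sub>R x | x.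
        x \<in> {\<Sum>j\<le>Suc k. w j *\<^sub>R b j | b. \<forall>j\<le>Suc k. b j \<in> ?B j}}"
    proof
      fix v assume "v \<in> D k (Suc m) c"
      then obtain x y ys where v: "v = T (replicate k x @ y # ys @ zs)"
        and xy: "x \<in> U c" "y \<in> U c" "set ys \<subseteq> U c" "length ys = m"
        unfolding D_def by (auto simp: length_Suc_conv)
      define b where "b j = T (replicate (Suc k) (x + real j *\<^sub>R y) @ ys @ zs)" for j :: nat
      have "b j \<in> ?B j" for j
      proof -
        have "x + real j *\<^sub>R y \<in> U (c + real j * c)" using U xy Suc.prems by simp
        moreover have "set ys \<subseteq> U (c + real j * c)" using U_mono[of c "c + real j * c"] xy Suc.prems by auto
        ultimately show ?thesis unfolding b_def D_def using xy by blast
      qed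
      moreover have "b j = (\<Sum>i\<le>Suc k. real j ^ i *\<^sub>R real (Suc k choose i) *\<^sub>R
          T (replicate (Suc k - i) x @ replicate i y @ ys @ zs))" for j
        unfolding b_def
        by (rule symmetric_multilinear_binomial[OF T]) (use n Suc.prems xy in auto)
      then have "(\<Sum>j\<le>Suc k. w j *\<^sub>R b j) = real (Suc k) *\<^sub>R v"
        by (simp only: w) (simp add: v)
      ultimately show "v \<in> {inverse (real (Suc k)) *\<^sub>R x | x.
        x \<in> {\<Sum>j\<le>Suc k. w j *\<^sub>R b j | b. \<forall>j\<le>Suc k. b j \<in> ?B j}}"
        by (intro CollectI exI[of _ "real (Suc k) *\<^sub>R v"] conjI) (simp, metis)
    qed
    then show ?case by (rule set_idealD(1)[OF I set_idealD(3)[OF I comb]])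
  qed
  from this[of 0 n c] have D: "D 0 n c \<in> \<B>" using c by simp
  \<comment> \<open>For \<open>k = 0\<close> the repeated entry no longer occurs in the list, but
    \<open>D\<close> still asks for one; hence the assumption \<open>ne\<close>.\<close>
  moreover have "{T (xs @ zs) | xs. set xs \<subseteq> U c \<and> length xs = n} = D 0 n c"
    using ne unfolding D_def by auto
  ultimately show ?thesis by simp
qed

lemma polarization_zero:
  fixes T :: "'a::real_vector list \<Rightarrow> 'b::real_vector" and U :: "'a set"
  assumes T: "symmetric_multilinear s T"
    and U: "\<And>x y t. x \<in> U \<Longrightarrow> y \<in> U \<Longrightarrow> 0 \<le> t \<Longrightarrow> x + t *\<^sub>R y \<in> U"
    and diag: "\<And>x. x \<in> U \<Longrightarrow> T (replicate (length xs) x @ zs) = 0"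
    and "length xs + length zs = s" "set xs \<subseteq> U" "U \<noteq> {}"
  shows "T (xs @ zs) = 0"
proof -
  have "{T (ys @ zs) | ys. set ys \<subseteq> U \<and> length ys = length xs} \<in> Pow {0}"
    by (rule polarization[where U = "\<lambda>_. U" and c = 0 and s = s])
       (use assms set_ideal_zero in auto)
  then show ?thesis using assms by auto
qed

section \<open>Real lattice homomorphisms\<close>

lemma vector_sublatticeD:
  assumes "vector_sublattice L"
  shows "0 \<in> L" "x \<in> L \<Longrightarrow> y \<in> L \<Longrightarrow> x + y \<in> L" "x \<in> L \<Longrightarrow> c *\<^sub>R x \<in> L"
    "x \<in> L \<Longrightarrow> - x \<in> L" "x \<in> L \<Longrightarrow> y \<in> L \<Longrightarrow> x - y \<in> L"
    "x \<in> L \<Longrightarrow> y \<in> L \<Longrightarrow> sup x y \<in> L" "x \<in> L \<Longrightarrow> y \<in> L \<Longrightarrow> inf x y \<in> L"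
    "x \<in> L \<Longrightarrow> \<bar>x\<bar> \<in> L"
proof -
  have s: "subspace L" and l: "x \<in> L \<Longrightarrow> y \<in> L \<Longrightarrow> sup x y \<in> L" "x \<in> L \<Longrightarrow> y \<in> L \<Longrightarrow> inf x y \<in> L"
    for x y using assms unfolding vector_sublattice_def by blast+
  show "0 \<in> L" "x \<in> L \<Longrightarrow> y \<in> L \<Longrightarrow> x + y \<in> L" "x \<in> L \<Longrightarrow> c *\<^sub>R x \<in> L"
    "x \<in> L \<Longrightarrow> - x \<in> L" "x \<in> L \<Longrightarrow> y \<in> L \<Longrightarrow> x - y \<in> L"
    "x \<in> L \<Longrightarrow> y \<in> L \<Longrightarrow> sup x y \<in> L" "x \<in> L \<Longrightarrow> y \<in> L \<Longrightarrow> inf x y \<in> L"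
    using s l by (auto intro: subspace_0 subspace_add subspace_scale subspace_neg subspace_diff)
  show "x \<in> L \<Longrightarrow> \<bar>x\<bar> \<in> L"
    unfolding abs_lattice using s l by (simp add: subspace_neg)
qed

lemma real_lattice_hom_onD:
  assumes "real_lattice_hom_on L \<omega>"
  shows "x \<in> L \<Longrightarrow> y \<in> L \<Longrightarrow> \<omega> (x + y) = \<omega> x + \<omega> y"
    "x \<in> L \<Longrightarrow> \<omega> (c *\<^sub>R x) = c * \<omega> x"
    "x \<in> L \<Longrightarrow> y \<in> L \<Longrightarrow> \<omega> (sup x y) = max (\<omega> x) (\<omega> y)"
    "x \<in> L \<Longrightarrow> y \<in> L \<Longrightarrow> \<omega> (inf x y) = min (\<omega> x) (\<omega> y)"
    "x \<in> L \<Longrightarrow> \<omega> (- x) = - \<omega> x"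
proof -
  show s: "x \<in> L \<Longrightarrow> \<omega> (c *\<^sub>R x) = c * \<omega> x" for c
    using assms unfolding real_lattice_hom_on_def by blast
  from s[of "-1"] show "x \<in> L \<Longrightarrow> \<omega> (- x) = - \<omega> x" by simp
qed (use assms in \<open>simp_all add: real_lattice_hom_on_def\<close>)

lemma real_lattice_hom_on_mono:
  assumes "real_lattice_hom_on L \<omega>" "x \<in> L" "y \<in> L" "x \<le> y"
  shows "\<omega> x \<le> \<omega> y"
  using real_lattice_hom_onD(3)[OF assms(1-3)] assms(4) by (simp add: sup_absorb2)

lemma real_lattice_hom_on_subset:
  assumes "real_lattice_hom_on L \<omega>" "M \<subseteq> L"
  shows "real_lattice_hom_on M \<omega>"
  using assms unfolding real_lattice_hom_on_def by (simp add: subset_iff)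

text \<open>The sublinear functionals of the Hahn--Banach argument, with preservation of binary
  suprema added. A minimal functional of this kind turns out to be linear, and is then a lattice
  homomorphism.\<close>

definition sup_sublinear_on :: "'a::archimedean_vector_lattice set \<Rightarrow> ('a \<Rightarrow> real) \<Rightarrow> bool" where
  "sup_sublinear_on A q \<longleftrightarrow>
    (\<forall>x\<in>A. \<forall>y\<in>A. q (x + y) \<le> q x + q y) \<and>
    (\<forall>c\<ge>0. \<forall>x\<in>A. q (c *\<^sub>R x) = c * q x) \<and>
    (\<forall>x\<in>A. \<forall>y\<in>A. q (sup x y) = max (q x) (q y))"

lemma sup_sublinear_onD:
  assumes "sup_sublinear_on A q"
  shows "x \<in> A \<Longrightarrow> y \<in> A \<Longrightarrow> q (x + y) \<le> q x + q y"
    "x \<in> A \<Longrightarrow> 0 \<le> c \<Longrightarrow> q (c *\<^sub>R x) = c * q x"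
    "x \<in> A \<Longrightarrow> y \<in> A \<Longrightarrow> q (sup x y) = max (q x) (q y)"
    "x \<in> A \<Longrightarrow> q 0 = 0"
    "x \<in> A \<Longrightarrow> y \<in> A \<Longrightarrow> x \<le> y \<Longrightarrow> q x \<le> q y"
proof -
  show h: "x \<in> A \<Longrightarrow> 0 \<le> c \<Longrightarrow> q (c *\<^sub>R x) = c * q x" for c
    using assms unfolding sup_sublinear_on_def by blast
  from h[of 0] show "x \<in> A \<Longrightarrow> q 0 = 0" by simp
  show s: "x \<in> A \<Longrightarrow> y \<in> A \<Longrightarrow> q (sup x y) = max (q x) (q y)"
    using assms unfolding sup_sublinear_on_def by blast
  then show "x \<in> A \<Longrightarrow> y \<in> A \<Longrightarrow> x \<le> y \<Longrightarrow> q x \<le> q y"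
    by (simp add: sup_absorb2)
qed (use assms in \<open>simp add: sup_sublinear_on_def\<close>)

lemma sup_sublinear_on_cong:
  assumes "vector_sublattice A" "\<And>x. x \<in> A \<Longrightarrow> p x = q x" "sup_sublinear_on A q"
  shows "sup_sublinear_on A p"
  using assms(3) vector_sublatticeD[OF assms(1)] unfolding sup_sublinear_on_def
  by (simp add: assms(2))

text \<open>Common core of four constructions: the shifted functional, the infimum of a chain, the
  extension of a homomorphism and the gauge of \<open>e\<close>. All are pointwise infima, so
  one-sided inequalities between members suffice: \<open>join\<close> gives one half of the rule for
  suprema and \<open>mono\<close> the other, and the reverse half of homogeneity comes from the
  factor \<open>1 / c\<close>.\<close>

lemma sup_sublinear_on_Inf:
  assumes A: "vector_sublattice A"
    and ne: "\<And>x. x \<in> A \<Longrightarrow> G x \<noteq> {}" and bdd: "\<And>x. x \<in> A \<Longrightarrow> bdd_below (G x)"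
    and add: "\<And>x y a b. x \<in> A \<Longrightarrow> y \<in> A \<Longrightarrow> a \<in> G x \<Longrightarrow> b \<in> G y \<Longrightarrow> \<exists>c\<in>G (x + y). c \<le> a + b"
    and scale: "\<And>x a c. x \<in> A \<Longrightarrow> a \<in> G x \<Longrightarrow> 0 < c \<Longrightarrow> \<exists>b\<in>G (c *\<^sub>R x). b \<le> c * a"
    and join: "\<And>x y a b. x \<in> A \<Longrightarrow> y \<in> A \<Longrightarrow> a \<in> G x \<Longrightarrow> b \<in> G y \<Longrightarrow> \<exists>c\<in>G (sup x y). c \<le> max a b"
    and mono: "\<And>x y a. x \<in> A \<Longrightarrow> y \<in> A \<Longrightarrow> a \<in> G y \<Longrightarrow> x \<le> y \<Longrightarrow> \<exists>b\<in>G x. b \<le> a"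
  shows "sup_sublinear_on A (\<lambda>x. Inf (G x))"
proof -
  note closed = vector_sublatticeD[OF A]
  have lower: "Inf (G x) \<le> a" if "x \<in> A" "b \<in> G x" "b \<le> a" for x a b
    using cInf_lower[OF that(2) bdd[OF that(1)]] that(3) by simp
  have scale_le: "Inf (G (c *\<^sub>R x)) \<le> c * Inf (G x)" if "x \<in> A" "0 < c" for x c
  proof -
    have "Inf (G (c *\<^sub>R x)) / c \<le> Inf (G x)"
    proof (rule cInf_greatest[OF ne[OF that(1)]])
      fix a assume "a \<in> G x"
      then obtain b where "b \<in> G (c *\<^sub>R x)" "b \<le> c * a" using scale \<open>x \<in> A\<close> \<open>0 < c\<close> by blast
      then have "Inf (G (c *\<^sub>R x)) \<le> c * a" using lower closed that by blast
      then show "Inf (G (c *\<^sub>R x)) / c \<le> a" using that by (simp add: field_simps)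
    qed
    then show ?thesis using that by (simp add: field_simps)
  qed
  \<comment> \<open>The factor 1/2 gives \<open>Inf (G 0) \<le> 0\<close>, the factor 2 the opposite
    inequality.\<close>
  have zero: "Inf (G 0) = 0"
    using scale_le[OF closed(1), of "1/2"] scale_le[OF closed(1), of 2] by simp
  show ?thesis
    unfolding sup_sublinear_on_def
  proof (intro conjI ballI allI impI)
    fix x y assume xy: "x \<in> A" "y \<in> A"
    have "Inf (G (x + y)) - Inf (G y) \<le> Inf (G x)"
    proof (rule cInf_greatest[OF ne[OF xy(1)]])
      fix a assume a: "a \<in> G x"
      have "Inf (G (x + y)) - a \<le> Inf (G y)"
      proof (rule cInf_greatest[OF ne[OF xy(2)]])
        fix b assume "b \<in> G y"
        then obtain c where "c \<in> G (x + y)" "c \<le> a + b" using add xy a by blast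
        then have "Inf (G (x + y)) \<le> a + b" using lower closed xy by blast
        then show "Inf (G (x + y)) - a \<le> b" by simp
      qed
      then show "Inf (G (x + y)) - Inf (G y) \<le> a" by simp
    qed
    then show "Inf (G (x + y)) \<le> Inf (G x) + Inf (G y)" by simp
    have "Inf (G (sup x y)) \<le> max (Inf (G x)) (Inf (G y)) + \<epsilon>" if "0 < \<epsilon>" for \<epsilon>
    proof -
      obtain a where a: "a \<in> G x" "a < Inf (G x) + \<epsilon>"
        using \<open>0 < \<epsilon>\<close> cInf_lessD[OF ne[OF xy(1)], of "Inf (G x) + \<epsilon>"] by auto
      obtain b where b: "b \<in> G y" "b < Inf (G y) + \<epsilon>"
        using \<open>0 < \<epsilon>\<close> cInf_lessD[OF ne[OF xy(2)], of "Inf (G y) + \<epsilon>"] by auto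
      obtain c where "c \<in> G (sup x y)" "c \<le> max a b" using join xy a b by blast
      then have "Inf (G (sup x y)) \<le> max a b" by (rule lower[OF closed(6)[OF xy]])
      then show ?thesis using a b by linarith
    qed
    then have "Inf (G (sup x y)) \<le> max (Inf (G x)) (Inf (G y))" by (rule field_le_epsilon)
    moreover have "Inf (G z) \<le> Inf (G (sup x y))" if "z \<in> A" "z \<le> sup x y" for z
    proof (rule cInf_greatest[OF ne])
      show "sup x y \<in> A" by (rule closed(6)[OF xy])
      fix a assume "a \<in> G (sup x y)"
      from mono[OF \<open>z \<in> A\<close> closed(6)[OF xy] this \<open>z \<le> sup x y\<close>]
      obtain b where "b \<in> G z" "b \<le> a" by (rule bexE)
      then show "Inf (G z) \<le> a" by (rule lower[OF \<open>z \<in> A\<close>])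
    qed
    ultimately show "Inf (G (sup x y)) = max (Inf (G x)) (Inf (G y))"
      using xy by (simp add: antisym)
  next
    fix c :: real and x assume cx: "0 \<le> c" "x \<in> A"
    show "Inf (G (c *\<^sub>R x)) = c * Inf (G x)"
    proof (cases "c = 0")
      case True
      then show ?thesis using zero by simp
    next
      case False
      then have c: "0 < c" using cx by simp
      then have "Inf (G x) \<le> (1 / c) * Inf (G (c *\<^sub>R x))"
        using scale_le[OF closed(3)[OF cx(2)], of "1 / c" c] by simp
      then show ?thesis using scale_le[OF cx(2) c] c by (simp add: field_simps)
    qed
  qed
qed

lemma sup_sublinear_on_lower:
  assumes "vector_sublattice A" "sup_sublinear_on A q" "x \<in> A"
  shows "- q (- x) \<le> q x"
  using sup_sublinear_onD(1)[OF assms(2,3), of "- x"] sup_sublinear_onD(4)[OF assms(2,3)]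
    vector_sublatticeD(4)[OF assms(1,3)] assms(3)
  by simp

text \<open>The usual Hahn--Banach modification, which forces linearity along \<open>a\<close>; it preserves suprema
  because the infimum is taken over a decreasing family.\<close>

lemma sup_sublinear_on_shift:
  assumes A: "vector_sublattice A" and q: "sup_sublinear_on A q" and a: "a \<in> A"
  defines "G \<equiv> \<lambda>x. {q (x + t *\<^sub>R a) - t * q a | t. 0 \<le> t}"
  shows "sup_sublinear_on A (\<lambda>x. Inf (G x))"
    and "x \<in> A \<Longrightarrow> Inf (G x) \<le> q x"
    and "Inf (G (- a)) \<le> - q a"
proof -
  note closed = vector_sublatticeD[OF A]
  note qD = sup_sublinear_onD[OF q]
  have lower: "- q (- x) \<le> v" if x: "x \<in> A" and "v \<in> G x" for x v
  proof -
    obtain t where v: "v = q (x + t *\<^sub>R a) - t * q a" "0 \<le> t"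
      using \<open>v \<in> G x\<close> unfolding G_def by blast
    have "q (t *\<^sub>R a) \<le> q (- x) + q (x + t *\<^sub>R a)"
      using qD(1)[of "- x" "x + t *\<^sub>R a"] closed x a by simp
    then show ?thesis using v qD(2)[OF a v(2)] by simp
  qed
  then have bdd: "bdd_below (G x)" if "x \<in> A" for x using that by (auto intro!: bdd_belowI)
  have decr: "q (x + t *\<^sub>R a) - t * q a \<le> q (x + u *\<^sub>R a) - u * q a"
    if x: "x \<in> A" and u: "0 \<le> u" "u \<le> t" for x u t
  proof -
    have "q ((x + u *\<^sub>R a) + (t - u) *\<^sub>R a) \<le> q (x + u *\<^sub>R a) + q ((t - u) *\<^sub>R a)"
      by (rule qD(1)) (use closed x a in auto)
    also have "q ((t - u) *\<^sub>R a) = (t - u) * q a" using qD(2) a u by simp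
    finally show ?thesis by (simp add: algebra_simps)
  qed
  show "sup_sublinear_on A (\<lambda>x. Inf (G x))"
  proof (rule sup_sublinear_on_Inf[OF A])
    show "G x \<noteq> {}" for x unfolding G_def by auto
    show "bdd_below (G x)" if "x \<in> A" for x by (rule bdd[OF that])
  next
    fix x y v w assume xy: "x \<in> A" "y \<in> A" and "v \<in> G x" "w \<in> G y"
    then obtain t u where v: "v = q (x + t *\<^sub>R a) - t * q a" "0 \<le> t"
      and w: "w = q (y + u *\<^sub>R a) - u * q a" "0 \<le> u" unfolding G_def by blast
    have "q ((x + t *\<^sub>R a) + (y + u *\<^sub>R a)) \<le> q (x + t *\<^sub>R a) + q (y + u *\<^sub>R a)"
      by (rule qD(1)) (use closed xy a in auto)
    then have "q (x + y + (t + u) *\<^sub>R a) - (t + u) * q a \<le> v + w"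
      using v w by (simp add: algebra_simps)
    then show "\<exists>c\<in>G (x + y). c \<le> v + w" unfolding G_def using v w
      by (intro bexI[of _ "q (x + y + (t + u) *\<^sub>R a) - (t + u) * q a"]) (auto intro!: exI[of _ "t + u"])
    let ?m = "max t u"
    have "q (sup x y + ?m *\<^sub>R a) - ?m * q a = max (q (x + ?m *\<^sub>R a) - ?m * q a) (q (y + ?m *\<^sub>R a) - ?m * q a)"
      using qD(3)[of "x + ?m *\<^sub>R a" "y + ?m *\<^sub>R a"] closed xy a
      by (simp add: add_sup_distrib_right max_diff_distrib_left)
    also have "\<dots> \<le> max v w"
      using decr[of x t ?m] decr[of y u ?m] xy v w by auto
    finally show "\<exists>c\<in>G (sup x y). c \<le> max v w" unfolding G_def using v
      by (intro bexI[of _ "q (sup x y + ?m *\<^sub>R a) - ?m * q a"]) (auto intro!: exI[of _ ?m])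
  next
    fix x v and c :: real assume x: "x \<in> A" and "v \<in> G x" and c: "0 < c"
    then obtain t where v: "v = q (x + t *\<^sub>R a) - t * q a" "0 \<le> t" unfolding G_def by blast
    have "q (c *\<^sub>R x + (c * t) *\<^sub>R a) = c * q (x + t *\<^sub>R a)"
      using qD(2)[of "x + t *\<^sub>R a" c] closed x a c by (simp add: scaleR_add_right)
    then have "q (c *\<^sub>R x + (c * t) *\<^sub>R a) - (c * t) * q a = c * v"
      by (simp add: v(1) right_diff_distrib mult.assoc)
    then show "\<exists>b\<in>G (c *\<^sub>R x). b \<le> c * v" unfolding G_def using c v
      by (intro bexI[of _ "c * v"]) (auto intro!: exI[of _ "c * t"])
  next
    fix x y v assume xy: "x \<in> A" "y \<in> A" "x \<le> y" and "v \<in> G y"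
    then obtain t where v: "v = q (y + t *\<^sub>R a) - t * q a" "0 \<le> t" unfolding G_def by blast
    have "q (x + t *\<^sub>R a) - t * q a \<le> v" unfolding v
      using qD(5)[of "x + t *\<^sub>R a" "y + t *\<^sub>R a"] closed xy a by simp
    then show "\<exists>b\<in>G x. b \<le> v" unfolding G_def using v by blast
  qed
  have "q x \<in> G x" for x unfolding G_def by (auto intro!: exI[of _ 0])
  then show "x \<in> A \<Longrightarrow> Inf (G x) \<le> q x" using bdd by (simp add: cInf_lower)
  have "- q a \<in> G (- a)"
    unfolding G_def using qD(4)[OF a] by (auto intro!: exI[of _ 1])
  then show "Inf (G (- a)) \<le> - q a" using bdd closed a by (simp add: cInf_lower)
qed

lemma sup_sublinear_on_minimal:
  fixes A :: "'a::archimedean_vector_lattice set"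
  assumes A: "vector_sublattice A" and q: "sup_sublinear_on A q"
  obtains m where "sup_sublinear_on A m" "\<And>x. x \<in> A \<Longrightarrow> m x \<le> q x"
    "\<And>f x. sup_sublinear_on A f \<Longrightarrow> (\<And>y. y \<in> A \<Longrightarrow> f y \<le> m y) \<Longrightarrow> x \<in> A \<Longrightarrow> f x = m x"
proof -
  \<comment> \<open>Values outside \<open>A\<close> are fixed at 0; otherwise they could be lowered
    forever and nothing would be minimal.\<close>
  let ?restrict = "\<lambda>f x. if x \<in> A then f x else (0::real)"
  define S where "S = {f. sup_sublinear_on A f \<and> (\<forall>x\<in>A. f x \<le> q x) \<and> (\<forall>x. x \<notin> A \<longrightarrow> f x = 0)}"
  define P :: "('a \<Rightarrow> real) \<Rightarrow> ('a \<Rightarrow> real) \<Rightarrow> bool" where "P f g \<longleftrightarrow> g \<le> f" for f g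
  have "\<exists>m\<in>S. \<forall>f\<in>S. P m f \<longrightarrow> f = m"
  proof (rule predicate_Zorn)
    show "partial_order_on S (relation_of P S)"
      by (rule partial_order_on_relation_ofI) (auto simp: P_def)
  next
    fix C assume C: "C \<in> Chains (relation_of P S)"
    then have CS: "C \<subseteq> S" and tot: "\<And>f g. f \<in> C \<Longrightarrow> g \<in> C \<Longrightarrow> f \<le> g \<or> g \<le> f"
      unfolding Chains_def relation_of_def P_def by auto
    show "\<exists>u\<in>S. \<forall>a\<in>C. P a u"
    proof (cases "C = {}")
      case True
      have "?restrict q \<in> S" unfolding S_def using sup_sublinear_on_cong[OF A _ q] by auto
      then show ?thesis using True by auto
    next
      case False
      have sub: "sup_sublinear_on A f" and le: "\<And>x. x \<in> A \<Longrightarrow> f x \<le> q x" if "f \<in> C" for f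
        using CS that unfolding S_def by auto
      let ?G = "\<lambda>x. (\<lambda>f. f x) ` C"
      \<comment> \<open>The bound is the same for the whole chain, so its pointwise infimum is
        finite.\<close>
      have lower: "- q (- x) \<le> f x" if "x \<in> A" "f \<in> C" for x f
        using sup_sublinear_on_lower[OF A sub[OF that(2)] that(1)]
          le[OF that(2) vector_sublatticeD(4)[OF A that(1)]] by simp
      have bdd: "bdd_below (?G x)" if "x \<in> A" for x
        using lower[OF that] by (auto intro!: bdd_belowI)
      have min_in: "\<exists>h\<in>C. h \<le> f \<and> h \<le> g" if "f \<in> C" "g \<in> C" for f g
        using tot[OF that] that by auto
      have "sup_sublinear_on A (\<lambda>x. Inf (?G x))"
      proof (rule sup_sublinear_on_Inf[OF A])
        show "?G x \<noteq> {}" for x using False by simp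
        show "bdd_below (?G x)" if "x \<in> A" for x by (rule bdd[OF that])
      next
        fix x y a b assume xy: "x \<in> A" "y \<in> A" and "a \<in> ?G x" "b \<in> ?G y"
        then obtain f g where fg: "f \<in> C" "g \<in> C" "a = f x" "b = g y" by auto
        then obtain h where h: "h \<in> C" "h \<le> f" "h \<le> g" using min_in by blast
        have hx: "h x \<le> a" "h y \<le> b" using h fg by (auto simp: le_fun_def)
        show "\<exists>c\<in>?G (x + y). c \<le> a + b"
          using sup_sublinear_onD(1)[OF sub[OF h(1)] xy] hx h(1)
          by (intro bexI[of _ "h (x + y)"]) auto
        show "\<exists>c\<in>?G (sup x y). c \<le> max a b"
          using sup_sublinear_onD(3)[OF sub[OF h(1)] xy] hx h(1)
          by (intro bexI[of _ "h (sup x y)"] imageI) auto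
      next
        fix x a and c :: real assume "x \<in> A" "a \<in> ?G x" "0 < c"
        then show "\<exists>b\<in>?G (c *\<^sub>R x). b \<le> c * a"
          using sup_sublinear_onD(2)[OF sub] by fastforce
      next
        fix x y a assume "x \<in> A" "y \<in> A" "a \<in> ?G y" "x \<le> y"
        then show "\<exists>b\<in>?G x. b \<le> a"
          using sup_sublinear_onD(5)[OF sub] by blast
      qed
      then have "sup_sublinear_on A (?restrict (\<lambda>x. Inf (?G x)))"
        using sup_sublinear_on_cong[OF A] by (smt (verit))
      moreover have inf_le: "Inf (?G x) \<le> f x" if "x \<in> A" "f \<in> C" for x f
        using that bdd by (intro cInf_lower) auto
      moreover obtain f0 where "f0 \<in> C" using False by auto
      ultimately have "?restrict (\<lambda>x. Inf (?G x)) \<in> S"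
        unfolding S_def using le by (fastforce intro: order_trans)
      moreover have "P f (?restrict (\<lambda>x. Inf (?G x)))" if "f \<in> C" for f
        using inf_le[OF _ that] CS that unfolding P_def S_def le_fun_def by auto
      ultimately show ?thesis by blast
    qed
  qed
  then obtain m where m: "m \<in> S" and minimal: "\<And>f. f \<in> S \<Longrightarrow> f \<le> m \<Longrightarrow> f = m"
    unfolding P_def by blast
  show thesis
  proof (rule that[of m])
    show "sup_sublinear_on A m" "\<And>x. x \<in> A \<Longrightarrow> m x \<le> q x" using m unfolding S_def by auto
    fix f x assume f: "sup_sublinear_on A f" and fm: "\<And>y. y \<in> A \<Longrightarrow> f y \<le> m y" and x: "x \<in> A"
    have "?restrict f \<in> S"
      using sup_sublinear_on_cong[OF A _ f] fm m unfolding S_def by (auto intro: order_trans)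
    moreover have "?restrict f \<le> m" using fm m unfolding S_def le_fun_def by auto
    ultimately have "?restrict f x = m x" by (intro fun_cong[OF minimal])
    then show "f x = m x" using x by simp
  qed
qed

text \<open>On \<open>A\<close> a minimal \<open>m\<close> equals each of its shifts, and the shift
  along \<open>a\<close> forces \<open>m (- a) \<le> - m a\<close>. So \<open>m\<close> is odd; an
  odd subadditive functional is additive, and infima come from suprema by negation.\<close>

lemma real_lattice_hom_below:
  assumes A: "vector_sublattice A" and q: "sup_sublinear_on A q"
  obtains \<omega> where "real_lattice_hom_on A \<omega>" "\<And>x. x \<in> A \<Longrightarrow> \<omega> x \<le> q x"
proof -
  note closed = vector_sublatticeD[OF A]
  obtain m where m: "sup_sublinear_on A m" "\<And>x. x \<in> A \<Longrightarrow> m x \<le> q x"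
    and minimal: "\<And>f x. sup_sublinear_on A f \<Longrightarrow> (\<And>y. y \<in> A \<Longrightarrow> f y \<le> m y) \<Longrightarrow> x \<in> A \<Longrightarrow> f x = m x"
    using sup_sublinear_on_minimal[OF A q] by blast
  note mD = sup_sublinear_onD[OF m(1)]
  have neg: "m (- a) = - m a" if a: "a \<in> A" for a
  proof -
    note shift = sup_sublinear_on_shift[OF A m(1) a]
    have "m (- a) \<le> - m a"
      using minimal[OF shift(1,2) closed(4)[OF a]] shift(3) by simp
    then show ?thesis using sup_sublinear_on_lower[OF A m(1) a] by simp
  qed
  have add: "m (x + y) = m x + m y" if "x \<in> A" "y \<in> A" for x y
  proof -
    have "m (- x + - y) \<le> m (- x) + m (- y)" by (rule mD(1)) (use closed that in auto)
    then have "- m (x + y) \<le> - m x - m y"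
      using neg[of x] neg[of y] neg[of "x + y"] closed that by simp
    then show ?thesis using mD(1)[OF that] by simp
  qed
  have scale: "m (c *\<^sub>R x) = c * m x" if x: "x \<in> A" for c x
  proof (cases "0 \<le> c")
    case False
    then have "m ((- c) *\<^sub>R x) = (- c) * m x" by (intro mD(2)[OF x]) simp
    then show ?thesis using neg[of "c *\<^sub>R x"] closed x by simp
  qed (use mD(2)[OF x] in simp)
  have inf: "m (inf x y) = min (m x) (m y)" if "x \<in> A" "y \<in> A" for x y
    unfolding inf_eq_neg_sup using mD(3)[of "- x" "- y"] neg[of "sup (- x) (- y)"]
      neg[of x] neg[of y] closed(4)[OF that(1)] closed(4)[OF that(2)]
      closed(6)[OF closed(4)[OF that(1)] closed(4)[OF that(2)]] that by simp
  have "real_lattice_hom_on A m"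
    using add scale inf mD(3) unfolding real_lattice_hom_on_def by simp
  then show thesis using m(2) by (rule that)
qed

section \<open>Extending and separating homomorphisms in principal ideals\<close>

definition principal_ideal :: "'a::archimedean_vector_lattice \<Rightarrow> 'a set" where
  "principal_ideal e = {x. \<exists>c\<ge>0. - (c *\<^sub>R e) \<le> x \<and> x \<le> c *\<^sub>R e}"

lemma principal_idealE:
  assumes "x \<in> principal_ideal e"
  obtains c where "0 \<le> c" "- (c *\<^sub>R e) \<le> x" "x \<le> c *\<^sub>R e"
  using assms unfolding principal_ideal_def by auto

lemma vector_sublattice_principal_ideal:
  assumes e: "0 \<le> e"
  shows "vector_sublattice (principal_ideal e)"
proof -
  have up: "a *\<^sub>R e \<le> c *\<^sub>R e" if "a \<le> c" for a c :: real
    using scaleR_right_mono[OF that e] .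
  have join: "sup x y \<in> principal_ideal e \<and> inf x y \<in> principal_ideal e \<and> x + y \<in> principal_ideal e"
    if "x \<in> principal_ideal e" "y \<in> principal_ideal e" for x y
  proof -
    obtain c where c: "0 \<le> c" "- (c *\<^sub>R e) \<le> x" "x \<le> c *\<^sub>R e"
      using \<open>x \<in> principal_ideal e\<close> by (rule principal_idealE)
    obtain d where d: "0 \<le> d" "- (d *\<^sub>R e) \<le> y" "y \<le> d *\<^sub>R e"
      using \<open>y \<in> principal_ideal e\<close> by (rule principal_idealE)
    have cm: "- (max c d *\<^sub>R e) \<le> x" "x \<le> max c d *\<^sub>R e" "- (max c d *\<^sub>R e) \<le> y" "y \<le> max c d *\<^sub>R e"
    proof -
      have u: "c *\<^sub>R e \<le> max c d *\<^sub>R e" "d *\<^sub>R e \<le> max c d *\<^sub>R e" by (simp_all add: up)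
      show "- (max c d *\<^sub>R e) \<le> x" by (rule order_trans[OF le_imp_neg_le[OF u(1)] c(2)])
      show "- (max c d *\<^sub>R e) \<le> y" by (rule order_trans[OF le_imp_neg_le[OF u(2)] d(2)])
      show "x \<le> max c d *\<^sub>R e" by (rule order_trans[OF c(3) u(1)])
      show "y \<le> max c d *\<^sub>R e" by (rule order_trans[OF d(3) u(2)])
    qed
    have "0 \<le> max c d" using c by simp
    moreover have "- (max c d *\<^sub>R e) \<le> sup x y \<and> sup x y \<le> max c d *\<^sub>R e"
      using cm by (simp add: le_supI1)
    moreover have "- (max c d *\<^sub>R e) \<le> inf x y \<and> inf x y \<le> max c d *\<^sub>R e"
      using cm by (simp add: le_infI1)
    moreover have "- ((c + d) *\<^sub>R e) \<le> x + y \<and> x + y \<le> (c + d) *\<^sub>R e"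
      using add_mono[OF c(2) d(2)] add_mono[OF c(3) d(3)] by (simp add: scaleR_add_left)
    moreover have "0 \<le> c + d" using c d by simp
    ultimately show ?thesis unfolding principal_ideal_def by blast
  qed
  have scale: "a *\<^sub>R x \<in> principal_ideal e" if "x \<in> principal_ideal e" for a x
  proof -
    obtain c where c: "0 \<le> c" "- (c *\<^sub>R e) \<le> x" "x \<le> c *\<^sub>R e"
      using \<open>x \<in> principal_ideal e\<close> by (rule principal_idealE)
    have "- ((\<bar>a\<bar> * c) *\<^sub>R e) \<le> a *\<^sub>R x \<and> a *\<^sub>R x \<le> (\<bar>a\<bar> * c) *\<^sub>R e"
    proof (cases "0 \<le> a")
      case True
      then show ?thesis
        using scaleR_left_mono[OF c(2) True] scaleR_left_mono[OF c(3) True] by simp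
    next
      case False
      then have "a \<le> 0" by simp
      then show ?thesis
        using scaleR_left_mono_neg[OF c(2) \<open>a \<le> 0\<close>] scaleR_left_mono_neg[OF c(3) \<open>a \<le> 0\<close>] by simp
    qed
    moreover have "0 \<le> \<bar>a\<bar> * c" using c by simp
    ultimately show ?thesis unfolding principal_ideal_def by blast
  qed
  have "0 \<in> principal_ideal e" unfolding principal_ideal_def by (auto intro!: exI[of _ 0])
  then show ?thesis unfolding vector_sublattice_def subspace_def by (simp add: join scale)
qed

text \<open>Take a homomorphism below the infimum of \<open>\<omega> m\<close> over all
  \<open>m \<in> M\<close> above \<open>x\<close>. On \<open>M\<close> it is at most
  \<open>\<omega>\<close>, and applying this to \<open>- x\<close> gives equality. The infimum is
  finite because \<open>M\<close> contains the multiples of \<open>e\<close>, which bound every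
  element of the ideal from both sides.\<close>

lemma real_lattice_hom_extension:
  assumes e: "0 \<le> e" and M: "vector_sublattice M" "e \<in> M" "M \<subseteq> principal_ideal e"
    and \<omega>: "real_lattice_hom_on M \<omega>"
  obtains \<omega>' where "real_lattice_hom_on (principal_ideal e) \<omega>'" "\<And>x. x \<in> M \<Longrightarrow> \<omega>' x = \<omega> x"
proof -
  note A = vector_sublattice_principal_ideal[OF e]
  note closed = vector_sublatticeD[OF M(1)]
  note hom = real_lattice_hom_onD[OF \<omega>] and mono = real_lattice_hom_on_mono[OF \<omega>]
  let ?G = "\<lambda>x. {\<omega> m | m. m \<in> M \<and> x \<le> m}"
  have bdd: "bdd_below (?G x)" if x: "x \<in> principal_ideal e" for x
  proof -
    obtain c where c: "- (c *\<^sub>R e) \<le> x" using x by (rule principal_idealE)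
    have "\<omega> (- (c *\<^sub>R e)) \<le> \<omega> m" if "m \<in> M" "x \<le> m" for m
      using mono[of "- (c *\<^sub>R e)" m] closed M(2) c that by auto
    then show ?thesis by (auto intro!: bdd_belowI)
  qed
  have "sup_sublinear_on (principal_ideal e) (\<lambda>x. Inf (?G x))"
  proof (rule sup_sublinear_on_Inf[OF A])
    fix x assume x: "x \<in> principal_ideal e"
    show "bdd_below (?G x)" by (rule bdd[OF x])
    obtain c where "x \<le> c *\<^sub>R e" using x by (rule principal_idealE)
    then show "?G x \<noteq> {}" using closed M(2) by blast
  next
    fix x y a b assume "a \<in> ?G x" "b \<in> ?G y"
    then obtain m n where mn: "m \<in> M" "n \<in> M" "x \<le> m" "y \<le> n" "a = \<omega> m" "b = \<omega> n" by auto
    have in_G: "\<omega> (m + n) \<in> ?G (x + y)"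
      using add_mono[OF mn(3,4)] closed(2)[OF mn(1,2)] by auto
    have in_G': "\<omega> (sup m n) \<in> ?G (sup x y)"
      unfolding mem_Collect_eq
      by (intro exI[of _ "sup m n"] conjI refl sup_mono mn(3,4) closed(6)[OF mn(1,2)])
    show "\<exists>c\<in>?G (x + y). c \<le> a + b"
      by (rule bexI[OF _ in_G]) (simp add: hom(1)[OF mn(1,2)] mn(5,6))
    show "\<exists>c\<in>?G (sup x y). c \<le> max a b"
      by (rule bexI[OF _ in_G']) (simp add: hom(3)[OF mn(1,2)] mn(5,6))
  next
    fix x a and c :: real assume "a \<in> ?G x" "0 < c"
    then obtain m where m: "m \<in> M" "x \<le> m" "a = \<omega> m" by auto
    have "\<omega> (c *\<^sub>R m) \<in> ?G (c *\<^sub>R x)"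
      using m closed \<open>0 < c\<close> by (auto intro!: exI[of _ "c *\<^sub>R m"] scaleR_left_mono)
    then show "\<exists>b\<in>?G (c *\<^sub>R x). b \<le> c * a"
      by (rule bexI[rotated]) (simp add: hom(2)[OF m(1)] m(3))
  next
    fix x y a assume "a \<in> ?G y" "x \<le> y"
    then show "\<exists>b\<in>?G x. b \<le> a" by (auto intro: order_trans)
  qed
  then obtain \<omega>' where \<omega>': "real_lattice_hom_on (principal_ideal e) \<omega>'"
    and le: "\<And>x. x \<in> principal_ideal e \<Longrightarrow> \<omega>' x \<le> Inf (?G x)"
    using real_lattice_hom_below[OF A] by blast
  have le': "\<omega>' x \<le> \<omega> x" if "x \<in> M" for x
  proof -
    have "x \<in> principal_ideal e" using that M by blast
    then show ?thesis using le[of x] cInf_lower[OF _ bdd, of "\<omega> x" x] that by fastforce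
  qed
  have "\<omega>' x = \<omega> x" if "x \<in> M" for x
  proof -
    have "x \<in> principal_ideal e" using that M by blast
    then show ?thesis using le'[OF that] le'[OF closed(4)[OF that]] hom(5)[OF that]
        real_lattice_hom_onD(5)[OF \<omega>'] by simp
  qed
  then show thesis using \<omega>' that by blast
qed

text \<open>The functional lies below the gauge \<open>q y = inf {c. y \<le> c e}\<close>, where
  \<open>c\<close> may be negative. From \<open>q e \<le> 1\<close> and
  \<open>q (- e) \<le> - 1\<close> follows \<open>\<omega> e = 1\<close>. The Archimedean axiom
  gives \<open>q x > 0\<close>, and shifting \<open>q\<close> along \<open>x\<close> before passing
  to a homomorphism forces \<open>\<omega> x \<ge> q x\<close>.\<close>

lemma real_lattice_hom_separation:
  assumes e: "0 \<le> e" and x: "x \<in> principal_ideal e" "\<not> x \<le> 0"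
  obtains \<omega> where "real_lattice_hom_on (principal_ideal e) \<omega>" "\<omega> e = 1" "0 < \<omega> x"
proof -
  note A = vector_sublattice_principal_ideal[OF e]
  note closed = vector_sublatticeD[OF A]
  let ?G = "\<lambda>x. {c. x \<le> c *\<^sub>R e}"
  have up: "a *\<^sub>R e \<le> c *\<^sub>R e" if "a \<le> c" for a c :: real
    using scaleR_right_mono[OF that e] .
  have e_pos: "\<not> e \<le> 0"
  proof
    assume "e \<le> 0"
    then have "e = 0" using e by simp
    then show False using x unfolding principal_ideal_def by auto
  qed
  have nonneg: "0 \<le> c" if "0 \<le> c *\<^sub>R e" for c
  proof (rule ccontr)
    assume "\<not> 0 \<le> c"
    then have "(1 / c) *\<^sub>R (c *\<^sub>R e) \<le> (1 / c) *\<^sub>R 0"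
      using that by (intro scaleR_left_mono_neg) auto
    then show False using e_pos \<open>\<not> 0 \<le> c\<close> by simp
  qed
  have lower: "- c \<le> d" if "- (c *\<^sub>R e) \<le> y" "y \<le> d *\<^sub>R e" for c d y
  proof -
    have "- (c *\<^sub>R e) \<le> d *\<^sub>R e" using that by (rule order_trans)
    then have "0 \<le> (c + d) *\<^sub>R e" using le_minus_iff[of "c *\<^sub>R e"]
      by (simp add: scaleR_add_left minus_le_iff add.commute neg_le_iff_le le_eq_neg diff_le_eq[symmetric])
    then show ?thesis using nonneg by fastforce
  qed
  have bdd: "bdd_below (?G y)" if "y \<in> principal_ideal e" for y
  proof -
    obtain c where "- (c *\<^sub>R e) \<le> y" using \<open>y \<in> principal_ideal e\<close> by (rule principal_idealE)
    then show ?thesis using lower by (auto intro!: bdd_belowI)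
  qed
  have ne: "?G y \<noteq> {}" if "y \<in> principal_ideal e" for y
    using that unfolding principal_ideal_def by auto
  define q where "q y = Inf (?G y)" for y
  have q: "sup_sublinear_on (principal_ideal e) q"
    unfolding q_def
  proof (rule sup_sublinear_on_Inf[OF A])
    show "?G y \<noteq> {}" if "y \<in> principal_ideal e" for y by (rule ne[OF that])
    show "bdd_below (?G y)" if "y \<in> principal_ideal e" for y by (rule bdd[OF that])
  next
    fix y z a b assume ab: "a \<in> ?G y" "b \<in> ?G z"
    then have "y + z \<le> (a + b) *\<^sub>R e" by (simp add: scaleR_add_left add_mono)
    then show "\<exists>c\<in>?G (y + z). c \<le> a + b" by blast
    have "sup y z \<le> max a b *\<^sub>R e"
      using ab up[of a "max a b"] up[of b "max a b"] by (auto intro: order_trans)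
    then show "\<exists>c\<in>?G (sup y z). c \<le> max a b" by blast
  next
    fix y a and c :: real assume "a \<in> ?G y" "0 < c"
    then have "c *\<^sub>R y \<le> (c * a) *\<^sub>R e" using scaleR_left_mono[of y "a *\<^sub>R e" c] by simp
    then show "\<exists>b\<in>?G (c *\<^sub>R y). b \<le> c * a" by blast
  next
    fix y z a assume "a \<in> ?G z" "y \<le> z"
    then show "\<exists>b\<in>?G y. b \<le> a" by (auto intro: order_trans)
  qed
  have ein: "e \<in> principal_ideal e" unfolding principal_ideal_def
    using e by (auto intro!: exI[of _ 1] order_trans[of "- e" 0 e])
  have qx: "0 < q x"
  proof (rule ccontr)
    assume "\<not> 0 < q x"
    have "real n *\<^sub>R x \<le> e" for n :: nat
    proof -
      have "q x < 1 / (real n + 1)" using \<open>\<not> 0 < q x\<close> by (smt (verit) divide_pos_pos of_nat_0_le_iff)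
      then obtain c where c: "x \<le> c *\<^sub>R e" "c < 1 / (real n + 1)"
        using cInf_lessD[OF ne[OF x(1)]] unfolding q_def by auto
      have "real n *\<^sub>R x \<le> (real n * c) *\<^sub>R e"
        using scaleR_left_mono[OF c(1), of "real n"] by simp
      also have "\<dots> \<le> 1 *\<^sub>R e"
      proof (rule up)
        have "real n * c \<le> real n * (1 / (real n + 1))" using c by (intro mult_left_mono) auto
        also have "\<dots> \<le> 1" by (simp add: field_simps)
        finally show "real n * c \<le> 1" .
      qed
      finally show ?thesis by simp
    qed
    then show False using archimedean x by blast
  qed
  note shift = sup_sublinear_on_shift[OF A q x(1)]
  obtain \<omega> where \<omega>: "real_lattice_hom_on (principal_ideal e) \<omega>"
    and le: "\<And>y. y \<in> principal_ideal e \<Longrightarrow> \<omega> y \<le> Inf {q (y + t *\<^sub>R x) - t * q x | t. 0 \<le> t}"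
    using real_lattice_hom_below[OF A shift(1)] by blast
  have le_q: "\<omega> y \<le> q y" if "y \<in> principal_ideal e" for y
    using le[OF that] shift(2)[OF that] by simp
  have "\<omega> (- x) \<le> - q x" using le[OF closed(4)[OF x(1)]] shift(3) by simp
  then have "0 < \<omega> x" using qx real_lattice_hom_onD(5)[OF \<omega> x(1)] by simp
  moreover have "q e \<le> 1" "q (- e) \<le> - 1"
    unfolding q_def using ein closed(4)[OF ein] by (auto intro!: cInf_lower bdd)
  then have "\<omega> e = 1"
    using le_q[OF ein] le_q[OF closed(4)[OF ein]] real_lattice_hom_onD(5)[OF \<omega> ein] by simp
  ultimately show thesis using \<omega> that by blast
qed

section \<open>Functional calculus in a principal ideal\<close>

text \<open>Piecewise linear interpolation as a sum of ramps: those with \<open>k < j\<close> have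
  value 1 and telescope, the \<open>j\<close>-th carries the fractional part and later ones vanish.
  Ramps are lattice expressions in \<open>y\<close> and constants, so they have counterparts in the
  ideal.\<close>

lemma sum_clamp:
  fixes f :: "nat \<Rightarrow> real"
  assumes "j < n" "real j \<le> y" "y \<le> real j + 1"
  shows "(\<Sum>k<n. (f (Suc k) - f k) * max 0 (min 1 (y - real k)))
    = f j - f 0 + (f (Suc j) - f j) * (y - real j)"
proof -
  have "(\<Sum>k<m. (f (Suc k) - f k) * max 0 (min 1 (y - real k))) = f m - f 0" if "real m \<le> y" for m
    using that by (induction m) auto
  then have j: "(\<Sum>k<j. (f (Suc k) - f k) * max 0 (min 1 (y - real k))) = f j - f 0"
    using assms by blast
  have "(\<Sum>k<Suc j + d. (f (Suc k) - f k) * max 0 (min 1 (y - real k)))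
      = f j - f 0 + (f (Suc j) - f j) * (y - real j)" for d
  proof (induction d)
    case 0
    then show ?case using j assms by simp
  next
    case (Suc d)
    then show ?case using assms by simp
  qed
  from this[of "n - Suc j"] show ?thesis using assms by simp
qed

lemma piecewise_linear_approximation:
  fixes \<phi> :: "real \<Rightarrow> real"
  assumes "continuous_on {- c..c} \<phi>" "0 < c" "0 < \<epsilon>"
  obtains n h where "0 < (h::real)"
    "\<And>v. - c \<le> v \<Longrightarrow> v \<le> c \<Longrightarrow>
      \<bar>\<phi> v - (\<phi> (- c) + (\<Sum>k<n. (\<phi> (- c + h * real (Suc k)) - \<phi> (- c + h * real k)) *
        max 0 (min 1 ((v + c) / h - real k))))\<bar> \<le> \<epsilon>"
proof -
  have "uniformly_continuous_on {- c..c} \<phi>"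
    by (rule compact_uniformly_continuous[OF assms(1) compact_Icc])
  then obtain \<delta> where \<delta>: "0 < \<delta>"
    "\<And>u v. u \<in> {- c..c} \<Longrightarrow> v \<in> {- c..c} \<Longrightarrow> \<bar>u - v\<bar> < \<delta> \<Longrightarrow> \<bar>\<phi> u - \<phi> v\<bar> < \<epsilon>"
    unfolding uniformly_continuous_on_def dist_real_def using \<open>0 < \<epsilon>\<close> by metis
  obtain n :: nat where n: "2 * c / \<delta> < real n" using reals_Archimedean2 by blast
  then have n0: "0 < real n" using assms \<delta> by (smt (verit) divide_pos_pos)
  define h where "h = 2 * c / real n"
  have h: "0 < h" "h < \<delta>" "h * real n = 2 * c"
    using n n0 assms \<delta> unfolding h_def by (simp_all add: field_simps)
  define f where "f k = \<phi> (- c + h * real k)" for k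
  have "\<bar>\<phi> v - (\<phi> (- c) + (\<Sum>k<n. (f (Suc k) - f k) * max 0 (min 1 ((v + c) / h - real k))))\<bar> \<le> \<epsilon>"
    if v: "- c \<le> v" "v \<le> c" for v
  proof -
    let ?y = "(v + c) / h"
    have y: "0 \<le> ?y" "?y \<le> real n" using v h assms by (simp_all add: field_simps)
    \<comment> \<open>The \<open>min\<close> puts the right endpoint, where the floor is
      \<open>n\<close>, into the last cell.\<close>
    define j where "j = min (n - 1) (nat \<lfloor>?y\<rfloor>)"
    have fl: "real (nat \<lfloor>?y\<rfloor>) \<le> ?y" "?y < real (nat \<lfloor>?y\<rfloor>) + 1" using y(1) by linarith+
    have j: "j < n" "real j \<le> ?y" "?y \<le> real j + 1"
      using n0 y fl unfolding j_def by (auto simp: min_def of_nat_diff)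
    define s where "s = ?y - real j"
    have v_eq: "v = - c + h * real j + h * s" using h unfolding s_def by (simp add: field_simps)
    have s: "0 \<le> s" "s \<le> 1" using j unfolding s_def by auto
    have hs: "0 \<le> h * s" "h * s \<le> h" using s h by (simp_all add: mult_left_le)
    have "h * real (Suc j) \<le> h * real n" using j h by (intro mult_left_mono) auto
    then have grid: "- c + h * real j \<in> {- c..c}" "- c + h * real (Suc j) \<in> {- c..c}"
      using h assms by (auto simp: algebra_simps)
    have *: "\<bar>\<phi> v - f j\<bar> < \<epsilon>" "\<bar>\<phi> v - f (Suc j)\<bar> < \<epsilon>"
      unfolding f_def
    proof -
      have "\<bar>v - (- c + h * real j)\<bar> < \<delta>" using v_eq hs h(2) by linarith
      moreover have "v - (- c + h * real (Suc j)) = h * s - h" using v_eq by (simp add: algebra_simps)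
      then have "\<bar>v - (- c + h * real (Suc j))\<bar> < \<delta>" using hs h(2) by linarith
      ultimately show "\<bar>\<phi> v - \<phi> (- c + h * real j)\<bar> < \<epsilon>"
        "\<bar>\<phi> v - \<phi> (- c + h * real (Suc j))\<bar> < \<epsilon>"
        using \<delta>(2) grid v by auto
    qed
    \<comment> \<open>The interpolant is a convex combination of the two neighbouring grid values,
      and each of these is within \<open>\<epsilon>\<close> of \<open>\<phi> v\<close>.\<close>
    have "\<phi> v - (\<phi> (- c) + (\<Sum>k<n. (f (Suc k) - f k) * max 0 (min 1 (?y - real k))))
        = (1 - s) * (\<phi> v - f j) + s * (\<phi> v - f (Suc j))"
      unfolding sum_clamp[OF j] unfolding s_def[symmetric] by (simp add: f_def algebra_simps)
    also have "\<bar>\<dots>\<bar> \<le> (1 - s) * \<bar>\<phi> v - f j\<bar> + s * \<bar>\<phi> v - f (Suc j)\<bar>"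
      using s by (intro order_trans[OF abs_triangle_ineq]) (simp add: abs_mult)
    also have "\<dots> \<le> (1 - s) * \<epsilon> + s * \<epsilon>"
      using s * by (intro add_mono mult_left_mono) auto
    finally show ?thesis by (simp add: algebra_simps)
  qed
  then show thesis using that[of h n] h unfolding f_def by blast
qed

section \<open>The ideal of an order unit as an algebra of functions\<close>

locale order_unit =
  fixes e :: "'a::uniformly_complete_vector_lattice"
  assumes unit_nonneg: "0 \<le> e"
begin

abbreviation A :: "'a set" where
  "A \<equiv> principal_ideal e"

text \<open>Elements of the ideal are handled as bounded real functions on \<open>K\<close>; the
  normalization makes \<open>e\<close> the constant function 1.\<close>

definition K :: "('a \<Rightarrow> real) set" where
  "K = {\<omega>. real_lattice_hom_on A \<omega> \<and> \<omega> e = 1}"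

lemmas closed = vector_sublatticeD[OF vector_sublattice_principal_ideal[OF unit_nonneg]]

lemma unit_closed: "e \<in> A"
  unfolding principal_ideal_def using unit_nonneg
  by (auto intro!: exI[of _ 1] order_trans[of "- e" 0 e])

lemma sum_closed: "(\<And>i. i \<in> I \<Longrightarrow> f i \<in> A) \<Longrightarrow> sum f I \<in> A"
  by (induction I rule: infinite_finite_induct) (auto intro: closed)

lemma K_hom:
  assumes "\<omega> \<in> K"
  shows "x \<in> A \<Longrightarrow> y \<in> A \<Longrightarrow> \<omega> (x + y) = \<omega> x + \<omega> y"
    "x \<in> A \<Longrightarrow> \<omega> (c *\<^sub>R x) = c * \<omega> x"
    "x \<in> A \<Longrightarrow> y \<in> A \<Longrightarrow> \<omega> (sup x y) = max (\<omega> x) (\<omega> y)"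
    "x \<in> A \<Longrightarrow> y \<in> A \<Longrightarrow> \<omega> (inf x y) = min (\<omega> x) (\<omega> y)"
    "x \<in> A \<Longrightarrow> \<omega> (- x) = - \<omega> x"
    "x \<in> A \<Longrightarrow> y \<in> A \<Longrightarrow> \<omega> (x - y) = \<omega> x - \<omega> y"
    "x \<in> A \<Longrightarrow> \<omega> \<bar>x\<bar> = \<bar>\<omega> x\<bar>"
    "\<omega> e = 1" "\<omega> 0 = 0"
proof -
  have h: "real_lattice_hom_on A \<omega>" using assms unfolding K_def by simp
  note hD = real_lattice_hom_onD[OF h]
  show "x \<in> A \<Longrightarrow> y \<in> A \<Longrightarrow> \<omega> (x + y) = \<omega> x + \<omega> y"
    "x \<in> A \<Longrightarrow> \<omega> (c *\<^sub>R x) = c * \<omega> x"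
    "x \<in> A \<Longrightarrow> y \<in> A \<Longrightarrow> \<omega> (sup x y) = max (\<omega> x) (\<omega> y)"
    "x \<in> A \<Longrightarrow> y \<in> A \<Longrightarrow> \<omega> (inf x y) = min (\<omega> x) (\<omega> y)"
    "x \<in> A \<Longrightarrow> \<omega> (- x) = - \<omega> x"
    by (fact hD)+
  show "x \<in> A \<Longrightarrow> y \<in> A \<Longrightarrow> \<omega> (x - y) = \<omega> x - \<omega> y"
    using hD(1)[of x "- y"] hD(5)[of y] closed(4)[of y] by simp
  show "x \<in> A \<Longrightarrow> \<omega> \<bar>x\<bar> = \<bar>\<omega> x\<bar>"
    unfolding abs_lattice using hD(3)[of x "- x"] hD(5)[of x] closed(4)[of x] by (simp add: sup_max)
  show "\<omega> e = 1" using assms unfolding K_def by simp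
  show "\<omega> 0 = 0" using hD(2)[OF unit_closed, of 0] by simp
qed

lemma K_sum: "\<omega> \<in> K \<Longrightarrow> (\<And>i. i \<in> I \<Longrightarrow> f i \<in> A) \<Longrightarrow> \<omega> (sum f I) = (\<Sum>i\<in>I. \<omega> (f i))"
  by (induction I rule: infinite_finite_induct) (auto simp: K_hom sum_closed)

lemma le_iff_K:
  assumes "x \<in> A" "y \<in> A"
  shows "x \<le> y \<longleftrightarrow> (\<forall>\<omega>\<in>K. \<omega> x \<le> \<omega> y)"
proof
  assume "x \<le> y"
  then show "\<forall>\<omega>\<in>K. \<omega> x \<le> \<omega> y"
    using real_lattice_hom_on_mono[OF _ assms] unfolding K_def by auto
next
  assume *: "\<forall>\<omega>\<in>K. \<omega> x \<le> \<omega> y"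
  show "x \<le> y"
  proof (rule ccontr)
    assume "\<not> x \<le> y"
    then have "\<not> x - y \<le> 0" by simp
    then obtain \<omega> where \<omega>: "real_lattice_hom_on A \<omega>" "\<omega> e = 1" "0 < \<omega> (x - y)"
      using real_lattice_hom_separation[OF unit_nonneg closed(5)[OF assms]] by metis
    then have "\<omega> \<in> K" unfolding K_def by simp
    then show False using * \<omega>(3) K_hom(6)[OF _ assms] by fastforce
  qed
qed

lemma eq_iff_K: "x \<in> A \<Longrightarrow> y \<in> A \<Longrightarrow> x = y \<longleftrightarrow> (\<forall>\<omega>\<in>K. \<omega> x = \<omega> y)"
  using le_iff_K[of x y] le_iff_K[of y x] by (metis order_antisym order_refl)

lemma interval_iff_K:
  assumes "x \<in> A"
  shows "- (c *\<^sub>R e) \<le> x \<and> x \<le> c *\<^sub>R e \<longleftrightarrow> (\<forall>\<omega>\<in>K. \<bar>\<omega> x\<bar> \<le> c)"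
proof -
  have *: "\<bar>t\<bar> \<le> c \<longleftrightarrow> - c \<le> t \<and> t \<le> c" for t :: real by auto
  show ?thesis
    using le_iff_K[of "- (c *\<^sub>R e)" x] le_iff_K[of x "c *\<^sub>R e"] assms unit_closed
    unfolding * by (auto simp: closed K_hom)
qed

lemma K_bound:
  assumes "x \<in> A"
  obtains c where "0 \<le> c" "\<And>\<omega>. \<omega> \<in> K \<Longrightarrow> \<bar>\<omega> x\<bar> \<le> c"
  using principal_idealE[OF assms] interval_iff_K[OF assms] by metis

lemma abs_le_iff_K:
  assumes "x \<in> A"
  shows "\<bar>x\<bar> \<le> c *\<^sub>R e \<longleftrightarrow> (\<forall>\<omega>\<in>K. \<bar>\<omega> x\<bar> \<le> c)"
  using le_iff_K[of "\<bar>x\<bar>" "c *\<^sub>R e"] assms unit_closed by (simp add: closed K_hom)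

text \<open>Uniform completeness yields a limit relative to some regulator \<open>u\<close>, which
  may lie outside the ideal. The approximants are Cauchy relative to \<open>e\<close>, so
  \<open>\<bar>X n - x\<bar>\<close> is at most \<open>\<epsilon> e\<close> plus arbitrarily small
  multiples of \<open>u\<close>; the Archimedean axiom removes the latter, which puts
  \<open>x\<close> into the ideal and makes the convergence visible on \<open>K\<close>.\<close>

lemma uniform_limit_closed:
  assumes "\<And>\<epsilon>. 0 < \<epsilon> \<Longrightarrow> \<exists>x\<in>A. \<forall>\<omega>\<in>K. \<bar>\<phi> \<omega> - \<omega> x\<bar> \<le> \<epsilon>"
  shows "\<exists>x\<in>A. \<forall>\<omega>\<in>K. \<omega> x = \<phi> \<omega>"
proof -
  have "\<exists>x\<in>A. \<forall>\<omega>\<in>K. \<bar>\<phi> \<omega> - \<omega> x\<bar> \<le> 1 / (real n + 1)" for n :: nat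
    by (rule assms) simp
  then obtain X where X: "\<And>n. X n \<in> A" "\<And>n \<omega>. \<omega> \<in> K \<Longrightarrow> \<bar>\<phi> \<omega> - \<omega> (X n)\<bar> \<le> 1 / (real n + 1)"
    by metis
  have cauchy: "\<exists>N. \<forall>m\<ge>N. \<forall>n\<ge>N. \<bar>X m - X n\<bar> \<le> \<epsilon> *\<^sub>R e" if \<epsilon>: "0 < \<epsilon>" for \<epsilon> :: real
  proof -
    obtain N :: nat where N: "2 / \<epsilon> < real N" using reals_Archimedean2 by blast
    have small: "1 / (real n + 1) \<le> \<epsilon> / 2" if "N \<le> n" for n
    proof -
      have "2 / \<epsilon> < real n + 1" using N that by linarith
      then show ?thesis using \<epsilon> by (simp add: field_simps)
    qed
    have "\<bar>X m - X n\<bar> \<le> \<epsilon> *\<^sub>R e" if "N \<le> m" "N \<le> n" for m n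
    proof -
      have "\<bar>\<omega> (X m - X n)\<bar> \<le> \<epsilon>" if \<omega>: "\<omega> \<in> K" for \<omega>
        using X(2)[OF \<omega>, of m] X(2)[OF \<omega>, of n] small[OF \<open>N \<le> m\<close>] small[OF \<open>N \<le> n\<close>]
        unfolding K_hom(6)[OF \<omega> X(1) X(1)] by linarith
      then show ?thesis using abs_le_iff_K[OF closed(5)[OF X(1) X(1)]] by simp
    qed
    then show ?thesis by blast
  qed
  then have "relatively_uniformly_Cauchy X"
    unfolding relatively_uniformly_Cauchy_def using unit_nonneg by (intro exI[of _ e] conjI allI impI)
  then obtain x u where u: "0 \<le> u"
    and lim: "\<And>\<epsilon>::real. 0 < \<epsilon> \<Longrightarrow> \<exists>N. \<forall>n\<ge>N. \<bar>X n - x\<bar> \<le> \<epsilon> *\<^sub>R u"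
    using relatively_uniformly_Cauchy_converges unfolding relatively_uniformly_tendsto_def by meson
  have close: "\<exists>n\<ge>M. \<bar>X n - x\<bar> \<le> \<epsilon> *\<^sub>R e" if \<epsilon>: "0 < \<epsilon>" for \<epsilon> :: real and M :: nat
  proof -
    obtain N where N: "\<And>m n. N \<le> m \<Longrightarrow> N \<le> n \<Longrightarrow> \<bar>X m - X n\<bar> \<le> \<epsilon> *\<^sub>R e"
      using cauchy[OF \<epsilon>] by auto
    let ?n = "max M N"
    have "real k *\<^sub>R (\<bar>X ?n - x\<bar> - \<epsilon> *\<^sub>R e) \<le> u" for k :: nat
    proof -
      obtain N' where N': "\<And>m. N' \<le> m \<Longrightarrow> \<bar>X m - x\<bar> \<le> (1 / (real k + 1)) *\<^sub>R u"
        using lim[of "1 / (real k + 1)"] by auto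
      let ?m = "max N N'"
      have "\<bar>X ?n - x\<bar> \<le> \<bar>X ?n - X ?m\<bar> + \<bar>X ?m - x\<bar>"
        using abs_triangle_ineq[of "X ?n - X ?m" "X ?m - x"] by simp
      also have "\<dots> \<le> \<epsilon> *\<^sub>R e + (1 / (real k + 1)) *\<^sub>R u"
        by (intro add_mono N N') auto
      finally have "\<bar>X ?n - x\<bar> - \<epsilon> *\<^sub>R e \<le> (1 / (real k + 1)) *\<^sub>R u"
        by (simp add: diff_le_eq add.commute)
      then have "real k *\<^sub>R (\<bar>X ?n - x\<bar> - \<epsilon> *\<^sub>R e) \<le> real k *\<^sub>R (1 / (real k + 1)) *\<^sub>R u"
        by (rule scaleR_left_mono) simp
      also have "\<dots> = (real k / (real k + 1)) *\<^sub>R u" by simp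
      also have "\<dots> \<le> 1 *\<^sub>R u" by (rule scaleR_right_mono[OF _ u]) simp
      finally show ?thesis by simp
    qed
    then have "\<bar>X ?n - x\<bar> - \<epsilon> *\<^sub>R e \<le> 0" by (rule archimedean)
    then show ?thesis by (intro exI[of _ ?n]) simp
  qed
  have x: "x \<in> A"
  proof -
    obtain n where n: "\<bar>X n - x\<bar> \<le> 1 *\<^sub>R e" using close[of 1 0] by auto
    have "- (1 *\<^sub>R e) \<le> X n - x \<and> X n - x \<le> 1 *\<^sub>R e"
      using abs_le_D1[OF n] le_imp_neg_le[OF abs_le_D2[OF n]] unfolding minus_minus by blast
    then have "X n - x \<in> A" unfolding principal_ideal_def by (intro CollectI exI[of _ 1]) simp
    then show ?thesis using closed(5)[OF X(1)[of n]] by fastforce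
  qed
  have "\<omega> x = \<phi> \<omega>" if \<omega>: "\<omega> \<in> K" for \<omega>
  proof -
    have "\<bar>\<phi> \<omega> - \<omega> x\<bar> \<le> 0 + \<epsilon>" if \<epsilon>: "0 < \<epsilon>" for \<epsilon>
    proof -
      obtain M :: nat where M: "2 / \<epsilon> < real M" using reals_Archimedean2 by blast
      obtain n where n: "M \<le> n" "\<bar>X n - x\<bar> \<le> (\<epsilon> / 2) *\<^sub>R e" using close[of "\<epsilon> / 2" M] \<epsilon> by auto
      have "2 / \<epsilon> < real n + 1" using M n(1) by linarith
      then have "1 / (real n + 1) \<le> \<epsilon> / 2" using \<epsilon> by (simp add: field_simps)
      moreover have "\<bar>\<omega> (X n) - \<omega> x\<bar> \<le> \<epsilon> / 2"
        using abs_le_iff_K[THEN iffD1, OF closed(5)[OF X(1) x] n(2)] \<omega>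
        unfolding K_hom(6)[OF \<omega> X(1) x, symmetric] by blast
      ultimately show ?thesis using X(2)[OF \<omega>, of n] by linarith
    qed
    then have "\<bar>\<phi> \<omega> - \<omega> x\<bar> \<le> 0" by (rule field_le_epsilon)
    then show ?thesis by simp
  qed
  then show ?thesis using x by blast
qed

lemma continuous_calculus:
  assumes \<phi>: "continuous_on UNIV (\<phi> :: real \<Rightarrow> real)" and x: "x \<in> A"
  shows "\<exists>z\<in>A. \<forall>\<omega>\<in>K. \<omega> z = \<phi> (\<omega> x)"
proof (rule uniform_limit_closed)
  fix \<epsilon> :: real assume \<epsilon>: "0 < \<epsilon>"
  obtain b where b: "0 \<le> b" "\<And>\<omega>. \<omega> \<in> K \<Longrightarrow> \<bar>\<omega> x\<bar> \<le> b" using K_bound[OF x] by blast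
  \<comment> \<open>Adding 1 keeps the interval nondegenerate when \<open>b = 0\<close>.\<close>
  define c where "c = b + 1"
  have c: "0 < c" "\<And>\<omega>. \<omega> \<in> K \<Longrightarrow> - c \<le> \<omega> x \<and> \<omega> x \<le> c"
    using b unfolding c_def by (auto simp: abs_le_iff) (smt (verit))+
  have "continuous_on {- c..c} \<phi>" using \<phi> by (rule continuous_on_subset) simp
  then obtain n h where h: "0 < h" and approx: "\<And>v. - c \<le> v \<Longrightarrow> v \<le> c \<Longrightarrow>
      \<bar>\<phi> v - (\<phi> (- c) + (\<Sum>k<n. (\<phi> (- c + h * real (Suc k)) - \<phi> (- c + h * real k)) *
        max 0 (min 1 ((v + c) / h - real k))))\<bar> \<le> \<epsilon>"
    using piecewise_linear_approximation[OF _ c(1) \<epsilon>] by blast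
  define t where "t k = sup 0 (inf e ((1 / h) *\<^sub>R (x + c *\<^sub>R e) - real k *\<^sub>R e))" for k
  have t: "t k \<in> A" for k unfolding t_def by (intro closed x unit_closed)
  have \<omega>t: "\<omega> (t k) = max 0 (min 1 ((\<omega> x + c) / h - real k))" if "\<omega> \<in> K" for \<omega> k
    unfolding t_def using x unit_closed that by (simp add: K_hom closed add_divide_distrib)
  let ?z = "\<phi> (- c) *\<^sub>R e + (\<Sum>k<n. (\<phi> (- c + h * real (Suc k)) - \<phi> (- c + h * real k)) *\<^sub>R t k)"
  have z: "?z \<in> A" by (intro closed(2,3) sum_closed t unit_closed)
  have "\<bar>\<phi> (\<omega> x) - \<omega> ?z\<bar> \<le> \<epsilon>" if \<omega>: "\<omega> \<in> K" for \<omega>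
  proof -
    have "\<omega> ?z = \<phi> (- c) + (\<Sum>k<n. (\<phi> (- c + h * real (Suc k)) - \<phi> (- c + h * real k)) *
        max 0 (min 1 ((\<omega> x + c) / h - real k)))"
      using \<omega> t unit_closed by (simp add: K_hom K_sum closed sum_closed \<omega>t)
    then show ?thesis using approx[of "\<omega> x"] c(2)[OF \<omega>] by simp
  qed
  then show "\<exists>z\<in>A. \<forall>\<omega>\<in>K. \<bar>\<phi> (\<omega> x) - \<omega> z\<bar> \<le> \<epsilon>" using z by blast
qed

definition apply_fun :: "(real \<Rightarrow> real) \<Rightarrow> 'a \<Rightarrow> 'a" where
  "apply_fun \<phi> x = (SOME z. z \<in> A \<and> (\<forall>\<omega>\<in>K. \<omega> z = \<phi> (\<omega> x)))"

lemma apply_fun: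
  assumes "continuous_on UNIV \<phi>" "x \<in> A"
  shows "apply_fun \<phi> x \<in> A" "\<omega> \<in> K \<Longrightarrow> \<omega> (apply_fun \<phi> x) = \<phi> (\<omega> x)"
proof -
  have "\<exists>z. z \<in> A \<and> (\<forall>\<omega>\<in>K. \<omega> z = \<phi> (\<omega> x))" using continuous_calculus[OF assms] by blast
  from someI_ex[OF this] show "apply_fun \<phi> x \<in> A" "\<omega> \<in> K \<Longrightarrow> \<omega> (apply_fun \<phi> x) = \<phi> (\<omega> x)"
    unfolding apply_fun_def by auto
qed

text \<open>The calculus above is for functions of one variable, so the product is obtained from
  squares.\<close>

definition mult :: "'a \<Rightarrow> 'a \<Rightarrow> 'a" where
  "mult x y = (1 / 2) *\<^sub>R (apply_fun (\<lambda>t. t\<^sup>2) (x + y) - apply_fun (\<lambda>t. t\<^sup>2) x - apply_fun (\<lambda>t. t\<^sup>2) y)"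

lemma mult_closed: "x \<in> A \<Longrightarrow> y \<in> A \<Longrightarrow> mult x y \<in> A"
  unfolding mult_def by (intro closed apply_fun continuous_intros)

lemma K_mult:
  assumes "x \<in> A" "y \<in> A" "\<omega> \<in> K"
  shows "\<omega> (mult x y) = \<omega> x * \<omega> y"
proof -
  have sq: "apply_fun (\<lambda>t. t\<^sup>2) z \<in> A" "\<omega> (apply_fun (\<lambda>t. t\<^sup>2) z) = (\<omega> z)\<^sup>2" if "z \<in> A" for z
    using that assms(3) by (auto intro!: apply_fun continuous_intros)
  show ?thesis unfolding mult_def
    using assms by (simp add: K_hom closed sq) (simp add: power2_eq_square algebra_simps)
qed

end

section \<open>Orthogonally additive polynomials on a principal ideal\<close>

text \<open>The substitute for passing to a limit. Every real multiple of \<open>v\<close> is some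
  \<open>n v\<close> times a factor of modulus at most 1, so the line through \<open>v\<close> lies
  in the balanced hull of \<open>B\<close> and is a bounded subspace.\<close>

lemma separated_multiples_zero:
  fixes v :: "'b::real_vector"
  assumes "convex_bornology \<B>" "separated_bornology \<B>" "B \<in> \<B>"
    and "\<And>n::nat. 0 < n \<Longrightarrow> real n *\<^sub>R v \<in> B"
  shows "v = 0"
proof -
  let ?H = "{c *\<^sub>R x | c x. \<bar>c::real\<bar> \<le> 1 \<and> x \<in> B}"
  have closed: "\<forall>A\<in>\<B>. \<forall>A'. A' \<subseteq> A \<longrightarrow> A' \<in> \<B>"
    using assms(1) unfolding convex_bornology_def by (elim conjE)
  have bal: "\<forall>A\<in>\<B>. {c *\<^sub>R x | c x. \<bar>c::real\<bar> \<le> 1 \<and> x \<in> A} \<in> \<B>"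
    using assms(1) unfolding convex_bornology_def by (elim conjE)
  have "range (\<lambda>t::real. t *\<^sub>R v) \<subseteq> ?H"
  proof
    fix w assume "w \<in> range (\<lambda>t::real. t *\<^sub>R v)"
    then obtain t :: real where w: "w = t *\<^sub>R v" by auto
    obtain n :: nat where n: "\<bar>t\<bar> < real n" using reals_Archimedean2 by blast
    then have n0: "0 < n" by (cases n) auto
    have "\<bar>t / real n\<bar> \<le> 1" using n n0 by (simp add: field_simps)
    moreover have "w = (t / real n) *\<^sub>R (real n *\<^sub>R v)" using n0 w by simp
    ultimately show "w \<in> ?H" using assms(4)[OF n0] by blast
  qed
  moreover have "?H \<in> \<B>" using bal assms(3) by (rule bspec)
  ultimately have "range (\<lambda>t::real. t *\<^sub>R v) \<in> \<B>" using closed by blast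
  moreover have "subspace (range (\<lambda>t::real. t *\<^sub>R v))"
    by (rule linear_subspace_image) (auto intro: linear_scaleR_left subspace_UNIV)
  ultimately have "range (\<lambda>t::real. t *\<^sub>R v) = {0}"
    using assms(2) unfolding separated_bornology_def by simp
  then have "1 *\<^sub>R v = 0" by (metis rangeI singletonD)
  then show ?thesis by simp
qed

lemma symmetric_multilinear_scale:
  fixes T :: "'a::real_vector list \<Rightarrow> 'b::real_vector"
  assumes T: "symmetric_multilinear s T" and "k + length zs = s"
  shows "T (replicate k (t *\<^sub>R y) @ zs) = t ^ k *\<^sub>R T (replicate k y @ zs)"
  using assms(2)
proof (induction k arbitrary: zs)
  case 0
  then show ?case by simp
next
  case (Suc k)
  let ?u = "t *\<^sub>R y"
  interpret l: linear "\<lambda>v. T (replicate k ?u @ v # zs)"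
    by (rule symmetric_multilinear_linear[OF T]) (use Suc.prems in simp)
  have "T (replicate (Suc k) ?u @ zs) = T (replicate k ?u @ ?u # zs)"
    by (simp add: replicate_append_same[symmetric])
  also have "\<dots> = t *\<^sub>R T (replicate k ?u @ y # zs)" by (rule l.scale)
  also have "\<dots> = t *\<^sub>R (t ^ k *\<^sub>R T (replicate k y @ y # zs))"
    using Suc.IH[of "y # zs"] Suc.prems by simp
  also have "replicate k y @ y # zs = replicate (Suc k) y @ zs"
    by (simp add: replicate_append_same[symmetric])
  finally show ?case by simp
qed

locale orthogonally_additive_form = order_unit e
  for e :: "'a::uniformly_complete_vector_lattice" +
  fixes s :: nat and P :: "'a \<Rightarrow> 'b::real_vector" and T :: "'a list \<Rightarrow> 'b" and \<B> :: "'b set set"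
  assumes T: "symmetric_multilinear s T" and P_eq: "\<And>f. P f = T (replicate s f)"
    and degree: "2 \<le> s"
    and bornology: "convex_bornology \<B>" and separated: "separated_bornology \<B>"
    and bounded: "bounded_map P \<B>" and additive: "orthogonally_additive P"
begin

text \<open>Polarization over the order intervals with endpoints \<open>- c e\<close> and
  \<open>c e\<close>: on the diagonal the values are those of \<open>P\<close> on an order bounded
  set.\<close>

lemma form_bounded:
  assumes c: "0 \<le> c"
  obtains B where "B \<in> \<B>"
    "\<And>xs. length xs = s \<Longrightarrow> (\<And>x. x \<in> set xs \<Longrightarrow> x \<in> A \<and> (\<forall>\<omega>\<in>K. \<bar>\<omega> x\<bar> \<le> c)) \<Longrightarrow> T xs \<in> B"
proof -
  let ?U = "\<lambda>c. {- (c *\<^sub>R e)..c *\<^sub>R e}"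
  have "{T (xs @ []) | xs. set xs \<subseteq> ?U c \<and> length xs = s} \<in> \<B>"
  proof (rule polarization[where U = ?U, OF T set_ideal_bornology[OF bornology]])
    fix a b t :: real and x y assume x: "x \<in> ?U a" and y: "y \<in> ?U b" and t: "0 \<le> t"
    have "- (t *\<^sub>R b *\<^sub>R e) \<le> t *\<^sub>R y" "t *\<^sub>R y \<le> t *\<^sub>R b *\<^sub>R e"
      using y t scaleR_left_mono[of "- (b *\<^sub>R e)" y t] scaleR_left_mono[of y "b *\<^sub>R e" t] by auto
    then show "x + t *\<^sub>R y \<in> ?U (a + t * b)"
      using x add_mono[of "- (a *\<^sub>R e)" x "- (t *\<^sub>R b *\<^sub>R e)" "t *\<^sub>R y"]
        add_mono[of x "a *\<^sub>R e" "t *\<^sub>R y" "t *\<^sub>R b *\<^sub>R e"]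
      by (simp add: scaleR_add_left)
  next
    fix a b :: real assume "a \<le> b"
    then have "a *\<^sub>R e \<le> b *\<^sub>R e" by (rule scaleR_right_mono[OF _ unit_nonneg])
    then show "?U a \<subseteq> ?U b" by simp
  next
    fix c :: real
    have "P ` ?U c \<in> \<B>" using bounded unfolding bounded_map_def by blast
    then show "{T (replicate s x @ []) | x. x \<in> ?U c} \<in> \<B>"
      unfolding append_Nil2 P_eq[symmetric] image_def by (simp add: Bex_def conj_commute)
  next
    have "0 \<in> ?U c" using scaleR_nonneg_nonneg[OF c unit_nonneg] by simp
    then show "?U c \<noteq> {}" by blast
  qed (use c in auto)
  moreover have "T xs \<in> {T (xs @ []) | xs. set xs \<subseteq> ?U c \<and> length xs = s}"
    if "length xs = s" "\<And>x. x \<in> set xs \<Longrightarrow> x \<in> A \<and> (\<forall>\<omega>\<in>K. \<bar>\<omega> x\<bar> \<le> c)" for xs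
    using that interval_iff_K by fastforce
  ultimately show thesis using that by blast
qed

text \<open>The lower bound 1 on \<open>c\<close> leaves room for auxiliary arguments of size at
  most 1 in the same bounded set.\<close>

lemma list_bound:
  assumes "set xs \<subseteq> A"
  obtains c where "1 \<le> c" "\<And>x \<omega>. x \<in> set xs \<Longrightarrow> \<omega> \<in> K \<Longrightarrow> \<bar>\<omega> x\<bar> \<le> c"
proof -
  have "\<exists>c\<ge>1. \<forall>x\<in>set xs. \<forall>\<omega>\<in>K. \<bar>\<omega> x\<bar> \<le> c"
    using assms
  proof (induction xs)
    case (Cons x xs)
    then obtain c where c: "1 \<le> c" "\<forall>x\<in>set xs. \<forall>\<omega>\<in>K. \<bar>\<omega> x\<bar> \<le> c" by auto
    have "x \<in> A" using Cons.prems by simp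
    then obtain d where d: "0 \<le> d" "\<And>\<omega>. \<omega> \<in> K \<Longrightarrow> \<bar>\<omega> x\<bar> \<le> d" using K_bound by blast
    show ?case
      by (rule exI[of _ "max c d"]) (use c d in \<open>auto simp: le_max_iff_disj\<close>)
  qed auto
  then show thesis using that by blast
qed

text \<open>Within the ideal this is lattice disjointness; phrased through \<open>K\<close>, it
  turns arguments about supports into pointwise ones.\<close>

definition disj :: "'a \<Rightarrow> 'a \<Rightarrow> bool" where
  "disj x y \<longleftrightarrow> x \<in> A \<and> y \<in> A \<and> (\<forall>\<omega>\<in>K. \<omega> x = 0 \<or> \<omega> y = 0)"

lemma disjI: "x \<in> A \<Longrightarrow> y \<in> A \<Longrightarrow> (\<And>\<omega>. \<omega> \<in> K \<Longrightarrow> \<omega> x \<noteq> 0 \<Longrightarrow> \<omega> y = 0) \<Longrightarrow> disj x y"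
  unfolding disj_def by blast

lemma disj_sym: "disj x y \<Longrightarrow> disj y x"
  unfolding disj_def by blast

lemma disj_combination:
  assumes "disj x y" "disj x' y"
  shows "disj (x + t *\<^sub>R x') y"
proof (rule disjI)
  have A: "x \<in> A" "x' \<in> A" "y \<in> A" using assms unfolding disj_def by auto
  then show "x + t *\<^sub>R x' \<in> A" "y \<in> A" by (simp_all add: closed)
  fix \<omega> assume \<omega>: "\<omega> \<in> K" and ne: "\<omega> (x + t *\<^sub>R x') \<noteq> 0"
  have "\<omega> x = 0 \<or> \<omega> y = 0" "\<omega> x' = 0 \<or> \<omega> y = 0" using assms \<omega> unfolding disj_def by auto
  then show "\<omega> y = 0" using ne A \<omega> by (auto simp: K_hom closed)
qed

lemma additive_disj:
  assumes "disj x y"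
  shows "P (x + y) = P x + P y"
proof -
  have A: "x \<in> A" "y \<in> A" using assms unfolding disj_def by auto
  have "inf \<bar>x\<bar> \<bar>y\<bar> = 0"
    using eq_iff_K[of "inf \<bar>x\<bar> \<bar>y\<bar>" 0] A assms unfolding disj_def
    by (force simp: closed K_hom)
  then show ?thesis using additive unfolding orthogonally_additive_def by blast
qed

text \<open>Disjointness survives replacing \<open>y\<close> by \<open>j y\<close>, so additivity
  holds for every \<open>j\<close>. Comparing powers of \<open>j\<close> in the binomial expansion
  kills all coefficients except the two extreme ones.\<close>

lemma form_disjoint_diagonal:
  assumes xy: "disj x y" and m: "0 < m" "m < s"
  shows "T (replicate (s - m) x @ replicate m y) = 0"
proof -
  define C where "C i = real (s choose i) *\<^sub>R T (replicate (s - i) x @ replicate i y)" for i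
  define c where "c i = (if 0 < i \<and> i < s then C i else 0)" for i
  have "(\<Sum>i\<le>s. real j ^ i *\<^sub>R c i) = 0" for j
  proof -
    have y: "disj x (real j *\<^sub>R y)"
      using disj_combination[of 0 x y "real j"] disj_sym[OF xy] by (auto simp: disj_def closed K_hom)
    have "P (x + real j *\<^sub>R y) = (\<Sum>i\<le>s. real j ^ i *\<^sub>R C i)"
      using symmetric_multilinear_binomial[OF T, of s "[]" x "real j" y] unfolding P_eq C_def by simp
    moreover have "P (real j *\<^sub>R y) = real j ^ s *\<^sub>R C s"
      using symmetric_multilinear_scale[OF T, of s "[]" "real j" y] unfolding P_eq C_def by simp
    moreover have "P x = real j ^ 0 *\<^sub>R C 0" unfolding P_eq C_def by simp
    ultimately have "(\<Sum>i\<le>s. real j ^ i *\<^sub>R C i) = real j ^ 0 *\<^sub>R C 0 + real j ^ s *\<^sub>R C s"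
      using additive_disj[OF y] by simp
    also have "\<dots> = (\<Sum>i\<le>s. if i = 0 then real j ^ i *\<^sub>R C i else 0) +
        (\<Sum>i\<le>s. if i = s then real j ^ i *\<^sub>R C i else 0)" by simp
    finally have "0 = (\<Sum>i\<le>s. real j ^ i *\<^sub>R C i) - (\<Sum>i\<le>s. if i = 0 then real j ^ i *\<^sub>R C i else 0) -
        (\<Sum>i\<le>s. if i = s then real j ^ i *\<^sub>R C i else 0)" by simp
    also have "\<dots> = (\<Sum>i\<le>s. real j ^ i *\<^sub>R c i)"
      unfolding sum_subtractf[symmetric]
      by (rule sum.cong) (use degree in \<open>auto simp: c_def\<close>)
    finally show ?thesis by simp
  qed
  then have "c m = 0" by (rule vector_polynomial_zero) (use m in simp)
  then show ?thesis using m unfolding c_def C_def by simp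
qed

text \<open>Two polarizations: first the arguments in \<open>X\<close> vary against a repeated
  \<open>y\<close>, then those in \<open>Y\<close> vary against the fixed list \<open>X\<close>. The
  elements disjoint from given ones are closed under the combinations that this needs.\<close>

lemma form_disjoint_lists:
  assumes disj: "\<And>x y. x \<in> set X \<Longrightarrow> y \<in> set Y \<Longrightarrow> disj x y"
    and ne: "X \<noteq> []" "Y \<noteq> []" and len: "length X + length Y = s"
  shows "T (X @ Y) = 0"
proof -
  have X: "T (X @ replicate (length Y) y) = 0" if y: "\<And>x. x \<in> set X \<Longrightarrow> disj x y" for y
  proof (rule polarization_zero[OF T, where U = "{x. disj x y}"])
    fix x assume "x \<in> {x. disj x y}"
    then show "T (replicate (length X) x @ replicate (length Y) y) = 0"
      using form_disjoint_diagonal[of x y "length Y"] ne by (simp add: len[symmetric])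
  next
    show "{x. disj x y} \<noteq> {}" using y[of "hd X"] ne by auto
  qed (use disj_combination y len in auto)
  have "T (Y @ X) = 0"
  proof (rule polarization_zero[OF T, where U = "{y. \<forall>x\<in>set X. disj x y}"])
    fix y assume "y \<in> {y. \<forall>x\<in>set X. disj x y}"
    then have "T (X @ replicate (length Y) y) = 0" using X by simp
    then show "T (replicate (length Y) y @ X) = 0"
      using symmetric_multilinear_mset[OF T, of "replicate (length Y) y @ X" "X @ replicate (length Y) y"] len
      by simp
  next
    show "{y. \<forall>x\<in>set X. disj x y} \<noteq> {}" using disj[of _ "hd Y"] ne by auto
  next
    fix x y t assume "x \<in> {y. \<forall>x\<in>set X. disj x y}" "y \<in> {y. \<forall>x\<in>set X. disj x y}"
    then show "x + t *\<^sub>R y \<in> {y. \<forall>x\<in>set X. disj x y}" for t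
      using disj_combination disj_sym by simp
  qed (use disj len in auto)
  then show ?thesis using symmetric_multilinear_mset[OF T, of "X @ Y" "Y @ X"] len by simp
qed

text \<open>A further argument \<open>z\<close> is split by a function of \<open>u\<close> into two pieces, each of which can be added
  to one side at the cost of a narrower gap between \<open>a\<close> and \<open>b\<close>.\<close>

lemma form_separated_lists:
  assumes u: "u \<in> A" and ab: "a < b"
    and X: "\<And>x. x \<in> set X \<Longrightarrow> x \<in> A \<and> (\<forall>\<omega>\<in>K. a < \<omega> u \<longrightarrow> \<omega> x = 0)"
    and Y: "\<And>y. y \<in> set Y \<Longrightarrow> y \<in> A \<and> (\<forall>\<omega>\<in>K. \<omega> u < b \<longrightarrow> \<omega> y = 0)"
    and ne: "X \<noteq> []" "Y \<noteq> []" and len: "length X + length Y + length zs = s" and zs: "set zs \<subseteq> A"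
  shows "T (X @ Y @ zs) = 0"
  using ab X Y ne len zs
proof (induction zs arbitrary: a b X Y)
  case Nil
  have "disj x y" if "x \<in> set X" "y \<in> set Y" for x y
  proof (rule disjI)
    show "x \<in> A" "y \<in> A" using Nil.prems(2)[OF that(1)] Nil.prems(3)[OF that(2)] by auto
    fix \<omega> assume \<omega>: "\<omega> \<in> K" and "\<omega> x \<noteq> 0"
    then have "\<not> a < \<omega> u" using Nil.prems(2)[OF that(1)] by blast
    then have "\<omega> u < b" using Nil.prems(1) by simp
    then show "\<omega> y = 0" using Nil.prems(3)[OF that(2)] \<omega> by blast
  qed
  then show ?case using form_disjoint_lists[of X Y] Nil.prems by simp
next
  case (Cons z zs)
  \<comment> \<open>The function \<open>w\<close> below is 1 where \<open>u \<le> a'\<close> and 0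
    where \<open>u \<ge> b'\<close>. So \<open>z1 = z w\<close> can join \<open>X\<close> with the
    gap from \<open>b'\<close> to \<open>b\<close>, and \<open>z - z1\<close> can join
    \<open>Y\<close> with the gap from \<open>a\<close> to \<open>a'\<close>.\<close>
  define a' b' where "a' = (2 * a + b) / 3" and "b' = (a + 2 * b) / 3"
  have ab': "a < a'" "a' < b'" "b' < b" using Cons.prems(1) unfolding a'_def b'_def by auto
  have z: "z \<in> A" using Cons.prems by simp
  let ?\<phi> = "\<lambda>t. max 0 (min 1 ((b' - t) / (b' - a')))"
  define w where "w = apply_fun ?\<phi> u"
  have \<phi>: "continuous_on UNIV ?\<phi>" using ab' by (intro continuous_intros) auto
  have w: "w \<in> A" "\<And>\<omega>. \<omega> \<in> K \<Longrightarrow> \<omega> w = ?\<phi> (\<omega> u)"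
    unfolding w_def using apply_fun[OF \<phi> u] by auto
  define z1 where "z1 = mult z w"
  have z1: "z1 \<in> A" "\<And>\<omega>. \<omega> \<in> K \<Longrightarrow> \<omega> z1 = \<omega> z * ?\<phi> (\<omega> u)"
    unfolding z1_def using K_mult[OF z w(1)] w by (auto simp: mult_closed z)
  interpret l: linear "\<lambda>v. T ((X @ Y) @ v # zs)"
    by (rule symmetric_multilinear_linear[OF T]) (use Cons.prems in simp)
  have "T ((z1 # X) @ Y @ zs) = 0"
  proof (rule Cons.IH[OF ab'(3)])
    fix x assume x: "x \<in> set (z1 # X)"
    have "\<omega> z1 = 0" if "b' < \<omega> u" "\<omega> \<in> K" for \<omega>
    proof -
      have "(b' - \<omega> u) / (b' - a') \<le> 0" using that ab' by (intro divide_nonpos_pos) auto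
      then show ?thesis using z1(2)[OF that(2)] by (simp add: max_absorb1)
    qed
    then show "x \<in> A \<and> (\<forall>\<omega>\<in>K. b' < \<omega> u \<longrightarrow> \<omega> x = 0)"
      using x z1(1) Cons.prems(2) ab' by (auto; meson less_trans)
  qed (use Cons.prems in auto)
  moreover have "T (X @ ((z - z1) # Y) @ zs) = 0"
  proof (rule Cons.IH[OF ab'(1)])
    fix y assume y: "y \<in> set ((z - z1) # Y)"
    have "\<omega> (z - z1) = 0" if "\<omega> u < a'" "\<omega> \<in> K" for \<omega>
    proof -
      have "1 \<le> (b' - \<omega> u) / (b' - a')" using that ab' by (simp add: field_simps)
      then show ?thesis using z1(2)[OF that(2)] K_hom(6)[OF that(2) z z1(1)] by simp
    qed
    then show "y \<in> A \<and> (\<forall>\<omega>\<in>K. \<omega> u < a' \<longrightarrow> \<omega> y = 0)"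
      using y z1(1) z Cons.prems(3) ab' by (auto simp: closed; meson less_trans)
  qed (use Cons.prems in auto)
  moreover have "T ((z1 # X) @ Y @ zs) = T ((X @ Y) @ z1 # zs)"
    by (rule symmetric_multilinear_mset[OF T]) (use Cons.prems in auto)
  moreover have "T (X @ ((z - z1) # Y) @ zs) = T ((X @ Y) @ (z - z1) # zs)"
    by (rule symmetric_multilinear_mset[OF T]) (use Cons.prems in auto)
  ultimately show ?case using l.add[of z1 "z - z1"] by simp
qed

text \<open>The remaining arguments may meet both \<open>x\<close> and \<open>y\<close>, so a gap
  between the supports has to be created. Cutting \<open>y\<close> off at height
  \<open>1 / n\<close> does this: \<open>x\<close> vanishes where \<open>\<bar>y\<bar> > 0\<close>,
  and \<open>y - y'\<close> vanishes where \<open>\<bar>y\<bar> < 1 / n\<close>. Hence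
  \<open>n T(x, y, zs) = T(x, n y', zs)\<close>, and \<open>n y'\<close> is bounded by 1.\<close>

lemma form_orthosymmetric:
  assumes xy: "disj x y" and zs: "set zs \<subseteq> A" "length zs + 2 = s"
  shows "T (x # y # zs) = 0"
proof -
  have A: "x \<in> A" "y \<in> A" using xy unfolding disj_def by auto
  obtain c where c: "1 \<le> c" "\<And>z \<omega>. z \<in> set (x # zs) \<Longrightarrow> \<omega> \<in> K \<Longrightarrow> \<bar>\<omega> z\<bar> \<le> c"
    using list_bound[of "x # zs"] A zs by auto
  obtain B where B: "B \<in> \<B>"
    "\<And>xs. length xs = s \<Longrightarrow> (\<And>x. x \<in> set xs \<Longrightarrow> x \<in> A \<and> (\<forall>\<omega>\<in>K. \<bar>\<omega> x\<bar> \<le> c)) \<Longrightarrow> T xs \<in> B"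
    using form_bounded[of c] c(1) by auto
  interpret l: linear "\<lambda>v. T ([x] @ v # zs)"
    by (rule symmetric_multilinear_linear[OF T]) (use zs in simp)
  have "real n *\<^sub>R T (x # y # zs) \<in> B" if n: "0 < n" for n :: nat
  proof -
    define \<epsilon> where "\<epsilon> = 1 / real n"
    have \<epsilon>: "0 < \<epsilon>" "real n * \<epsilon> = 1" using n unfolding \<epsilon>_def by auto
    define y' where "y' = inf (sup y (- (\<epsilon> *\<^sub>R e))) (\<epsilon> *\<^sub>R e)"
    have y': "y' \<in> A" "\<And>\<omega>. \<omega> \<in> K \<Longrightarrow> \<omega> y' = min (max (\<omega> y) (- \<epsilon>)) \<epsilon>"
      unfolding y'_def using A(2) unit_closed by (auto simp: closed K_hom)
    have "T ([x] @ [y - y'] @ zs) = 0"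
    proof (rule form_separated_lists[OF closed(8)[OF A(2)] \<epsilon>(1)])
      show "z \<in> A \<and> (\<forall>\<omega>\<in>K. 0 < \<omega> \<bar>y\<bar> \<longrightarrow> \<omega> z = 0)" if "z \<in> set [x]" for z
        using that xy A unfolding disj_def by (auto simp: K_hom)
      show "z \<in> A \<and> (\<forall>\<omega>\<in>K. \<omega> \<bar>y\<bar> < \<epsilon> \<longrightarrow> \<omega> z = 0)" if "z \<in> set [y - y']" for z
      proof -
        have "\<omega> (y - y') = 0" if "\<omega> \<in> K" "\<omega> \<bar>y\<bar> < \<epsilon>" for \<omega>
          using y'(2)[OF that(1)] that A(2) y'(1) by (auto simp: min_def max_def K_hom)
        then show ?thesis using that A y'(1) by (simp add: closed)
      qed
    qed (use zs in auto)
    then have "T (x # y # zs) = T (x # y' # zs)" using l.diff[of y y'] by simp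
    then have "real n *\<^sub>R T (x # y # zs) = T (x # (real n *\<^sub>R y') # zs)"
      using l.scale[of "real n" y'] by simp
    also have "\<dots> \<in> B"
    proof (rule B(2))
      fix z assume z: "z \<in> set (x # (real n *\<^sub>R y') # zs)"
      have "\<bar>\<omega> (real n *\<^sub>R y')\<bar> \<le> c" if \<omega>: "\<omega> \<in> K" for \<omega>
      proof -
        have "\<bar>\<omega> y'\<bar> \<le> \<epsilon>" using y'(2)[OF \<omega>] \<epsilon> by auto
        then have "real n * \<bar>\<omega> y'\<bar> \<le> real n * \<epsilon>" by (rule mult_left_mono) simp
        then show ?thesis using \<epsilon> c(1) K_hom(2)[OF \<omega> y'(1)] by (simp add: abs_mult)
      qed
      then show "z \<in> A \<and> (\<forall>\<omega>\<in>K. \<bar>\<omega> z\<bar> \<le> c)"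
        using z c(2) A y'(1) zs by (auto simp: closed)
    qed (use zs in simp)
    finally show ?thesis .
  qed
  then show ?thesis by (rule separated_multiples_zero[OF bornology separated B(1)])
qed

text \<open>
  With \<open>u = (1/n) \<Sum> t\<^sub>k\<close> and hat functions \<open>\<sigma>\<^sub>k = t\<^sub>k - t\<^bsub>k+1\<^esub>\<close>, orthosymmetry turns \<open>n\<close> times the difference
  of the two sides into a sum of terms \<open>b(\<sigma>\<^bsub>k+1\<^esub>, \<sigma>\<^sub>k v) - b(\<sigma>\<^sub>k, \<sigma>\<^bsub>k+1\<^esub> v)\<close>.  Within a residue class of
  \<open>k\<close> modulo 3 the supports do not interact, so that each partial sum is a single value of \<open>b\<close> on
  arguments bounded independently of \<open>n\<close>.
\<close>

lemma form_transfer_unit_interval: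
  assumes u: "u \<in> A" "\<And>\<omega>. \<omega> \<in> K \<Longrightarrow> 0 \<le> \<omega> u \<and> \<omega> u \<le> 1" and v: "v \<in> A"
    and zs: "set zs \<subseteq> A" "length zs + 2 = s"
  shows "T (u # v # zs) = T (e # mult u v # zs)"
proof -
  define b where "b x y = T (x # y # zs)" for x y
  have lin1: "linear (\<lambda>x. b x y)" for y
    unfolding b_def using symmetric_multilinear_linear[OF T, of "[]" "y # zs"] zs by simp
  have lin2: "linear (b x)" for x
    unfolding b_def using symmetric_multilinear_linear[OF T, of "[x]" zs] zs by simp
  note b_lin = linear_add[OF lin1] linear_diff[OF lin1] linear_cmul[OF lin1] linear_sum[OF lin1]
    linear_add[OF lin2] linear_diff[OF lin2] linear_cmul[OF lin2] linear_sum[OF lin2]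
  have b_disj: "b x y = 0" if "disj x y" for x y
    unfolding b_def by (rule form_orthosymmetric[OF that zs])
  obtain c where c: "1 \<le> c" "\<And>z \<omega>. z \<in> set (v # zs) \<Longrightarrow> \<omega> \<in> K \<Longrightarrow> \<bar>\<omega> z\<bar> \<le> c"
    using list_bound[of "v # zs"] v zs by auto
  obtain B where B: "B \<in> \<B>"
    "\<And>xs. length xs = s \<Longrightarrow> (\<And>x. x \<in> set xs \<Longrightarrow> x \<in> A \<and> (\<forall>\<omega>\<in>K. \<bar>\<omega> x\<bar> \<le> c)) \<Longrightarrow> T xs \<in> B"
    using form_bounded[of c] c(1) by auto
  have bB: "b x y \<in> B" if "x \<in> A" "y \<in> A" "\<And>\<omega>. \<omega> \<in> K \<Longrightarrow> \<bar>\<omega> x\<bar> \<le> c"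
    "\<And>\<omega>. \<omega> \<in> K \<Longrightarrow> \<bar>\<omega> y\<bar> \<le> c" for x y
    unfolding b_def by (rule B(2)) (use that c(2) zs in auto)
  \<comment> \<open>Three residue classes occur with each of the two signs, and every class
    contributes a value in \<open>B\<close>; the resulting bounded set is fixed before
    \<open>n\<close>.\<close>
  let ?C = "\<lambda>w. {\<Sum>j\<le>2::nat. w *\<^sub>R g j | g. \<forall>j\<le>2. g j \<in> B}"
  let ?B' = "{x + y | x y. x \<in> ?C 1 \<and> y \<in> ?C (- 1)}"
  have I: "set_ideal \<B>" by (rule set_ideal_bornology[OF bornology])
  have B': "?B' \<in> \<B>"
    by (intro set_idealD(2)[OF I] set_ideal_combination[OF I]) (rule B(1))+
  have "real n *\<^sub>R (b u v - b e (mult u v)) \<in> ?B'" if n: "0 < n" for n :: nat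
  proof -
    \<comment> \<open>With the offset \<open>j - 1\<close>, taken in the reals, \<open>t 0\<close>
      equals \<open>e\<close>, and \<open>t (Suc k)\<close> rises from 0 to 1 while
      \<open>n u\<close> runs from \<open>k\<close> to \<open>k + 1\<close>.\<close>
    define t where "t j = sup 0 (inf e (real n *\<^sub>R u - (real j - 1) *\<^sub>R e))" for j
    define \<sigma> where "\<sigma> j = t j - t (Suc j)" for j
    define m where "m j = mult (t j) v" for j
    define \<mu> where "\<mu> j = m j - m (Suc j)" for j
    have t: "t j \<in> A" "\<And>\<omega>. \<omega> \<in> K \<Longrightarrow> \<omega> (t j) = max 0 (min 1 (real n * \<omega> u - (real j - 1)))" for j
      unfolding t_def using u(1) unit_closed by (auto simp: closed K_hom)
    have m: "m j \<in> A" "\<And>\<omega>. \<omega> \<in> K \<Longrightarrow> \<omega> (m j) = \<omega> (t j) * \<omega> v" for j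
      unfolding m_def using t(1) v by (auto simp: mult_closed K_mult)
    have \<sigma>: "\<sigma> j \<in> A" "\<And>\<omega>. \<omega> \<in> K \<Longrightarrow> \<omega> (\<sigma> j) = \<omega> (t j) - \<omega> (t (Suc j))" for j
      unfolding \<sigma>_def using t(1) by (auto simp: closed K_hom)
    have \<mu>: "\<mu> j \<in> A" "\<And>\<omega>. \<omega> \<in> K \<Longrightarrow> \<omega> (\<mu> j) = \<omega> (\<sigma> j) * \<omega> v" for j
      unfolding \<mu>_def using m(1) by (auto simp: closed K_hom m(2) \<sigma>(2) left_diff_distrib)
    have \<sigma>_nonneg: "0 \<le> \<omega> (\<sigma> j)" if "\<omega> \<in> K" for \<omega> j
      using \<sigma>(2)[OF that] t(2)[OF that] by auto
    have \<sigma>_support: "real j - 1 < real n * \<omega> u \<and> real n * \<omega> u < real j + 1"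
      if "\<omega> \<in> K" "\<omega> (\<sigma> j) \<noteq> 0" for \<omega> j
      using \<sigma>(2)[OF that(1)] t(2)[OF that(1)] that(2) by (auto simp: max_def min_def split: if_splits)
    have plateau: "\<omega> (t k) = 1" if "\<omega> \<in> K" "\<omega> (t (Suc k)) \<noteq> 0" for \<omega> k
      using t(2)[OF that(1), of k] t(2)[OF that(1), of "Suc k"] that(2)
      by (auto simp: max_def min_def split: if_splits)
    \<comment> \<open>Where \<open>t (Suc k)\<close> is nonzero, \<open>t k\<close> is 1;
      orthosymmetry therefore replaces \<open>v\<close> by \<open>m k\<close> in the first term and
      \<open>e\<close> by \<open>t k\<close> in the second. When the right-hand side is expanded,
      the terms \<open>b (t (Suc k)) (m (Suc k))\<close> cancel and those involving the index
      \<open>k + 2\<close> vanish.\<close>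
    have step: "b (t (Suc k)) v - b e (m (Suc k)) = b (\<sigma> (Suc k)) (\<mu> k) - b (\<sigma> k) (\<mu> (Suc k))" for k
    proof -
      have "b (t (Suc k)) (v - m k) = 0"
      proof (intro b_disj disjI)
        fix \<omega> assume \<omega>: "\<omega> \<in> K" and "\<omega> (t (Suc k)) \<noteq> 0"
        then have "\<omega> (t k) = 1" by (rule plateau)
        then show "\<omega> (v - m k) = 0" using \<omega> v m(1) m(2)[OF \<omega>] by (simp add: K_hom)
      qed (use t m v in \<open>auto simp: closed\<close>)
      moreover have "b (e - t k) (m (Suc k)) = 0"
      proof (intro b_disj disjI)
        fix \<omega> assume \<omega>: "\<omega> \<in> K" and "\<omega> (e - t k) \<noteq> 0"
        then have "\<omega> (t k) \<noteq> 1" using t(1) unit_closed by (simp add: K_hom)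
        then have "\<omega> (t (Suc k)) = 0" using plateau[OF \<omega>, of k] by blast
        then show "\<omega> (m (Suc k)) = 0" using m(2)[OF \<omega>] by simp
      qed (use t m unit_closed in \<open>auto simp: closed\<close>)
      moreover have \<sigma>_zero: "\<omega> (\<sigma> k) = 0" if \<omega>: "\<omega> \<in> K" "\<omega> (t (Suc (Suc k))) \<noteq> 0" for \<omega>
        using plateau[OF \<omega>] plateau[OF \<omega>(1), of k] \<sigma>(2)[OF \<omega>(1)] by simp
      have "b (t (Suc (Suc k))) (\<mu> k) = 0"
        by (intro b_disj disjI t(1) \<mu>(1)) (simp add: \<mu>(2) \<sigma>_zero)
      moreover have "b (\<sigma> k) (m (Suc (Suc k))) = 0"
      proof (intro b_disj disjI \<sigma>(1) m(1))
        fix \<omega> assume \<omega>: "\<omega> \<in> K" and "\<omega> (\<sigma> k) \<noteq> 0"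
        then have "\<omega> (t (Suc (Suc k))) = 0" using \<sigma>_zero by blast
        then show "\<omega> (m (Suc (Suc k))) = 0" using m(2)[OF \<omega>] by simp
      qed
      ultimately show ?thesis unfolding \<sigma>_def \<mu>_def by (simp add: b_lin algebra_simps)
    qed
    have u_sum: "real n *\<^sub>R u = (\<Sum>k<n. t (Suc k))"
    proof -
      have "(\<Sum>k<N. max 0 (min 1 (y - real k))) = min (real N) y" if "0 \<le> y" for N and y :: real
        using that by (induction N) auto
      then have "(\<Sum>k<n. \<omega> (t (Suc k))) = real n * \<omega> u" if "\<omega> \<in> K" for \<omega>
        unfolding t(2)[OF that] using u(2)[OF that] by (simp add: mult_left_le)
      then show ?thesis using u(1) t(1)
        by (subst eq_iff_K) (auto simp: closed sum_closed K_hom K_sum)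
    qed
    have uv_sum: "real n *\<^sub>R mult u v = (\<Sum>k<n. m (Suc k))"
    proof -
      have "\<omega> (real n *\<^sub>R u) = (\<Sum>k<n. \<omega> (t (Suc k)))" if "\<omega> \<in> K" for \<omega>
        unfolding u_sum using that t(1) by (simp add: K_sum)
      then have "real n * (\<omega> u * \<omega> v) = (\<Sum>k<n. \<omega> (m (Suc k)))" if \<omega>: "\<omega> \<in> K" for \<omega>
        unfolding m(2)[OF \<omega>] sum_distrib_right[symmetric]
        using K_hom(2)[OF \<omega> u(1), of "real n"] \<omega> by simp
      then show ?thesis using u(1) v m(1)
        by (subst eq_iff_K) (auto simp: closed sum_closed mult_closed K_hom K_sum K_mult)
    qed
    define S where "S r = {k \<in> {..<n}. k mod 3 = r}" for r
    have S: "finite (S r)" "S r \<subseteq> {..<n}" for r unfolding S_def by auto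
    have split: "(\<Sum>k<n. f k) = (\<Sum>r\<le>2. sum f (S r))" for f :: "nat \<Rightarrow> 'b"
      unfolding S_def by (rule sum.group[symmetric]) auto
    have apart: "k = l \<or> k + 3 \<le> l \<or> l + 3 \<le> k" if "k \<in> S r" "l \<in> S r" for k l r
    proof -
      have "3 * (k div 3) + r = k" "3 * (l div 3) + r = l"
        using that mult_div_mod_eq[of 3 k] mult_div_mod_eq[of 3 l] unfolding S_def by auto
      then have "k = l \<or> k div 3 + 1 \<le> l div 3 \<or> l div 3 + 1 \<le> k div 3" 
        by (metis Suc_eq_plus1 linorder_neqE_nat Suc_leI)
      then show ?thesis using \<open>3 * (k div 3) + r = k\<close> \<open>3 * (l div 3) + r = l\<close> by linarith
    qed
    \<comment> \<open>The hats are nonnegative and telescope over the full range, so the bound does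
      not grow with \<open>n\<close>.\<close>
    have \<sigma>_sum: "\<bar>\<Sum>k\<in>S r. \<omega> (\<sigma> (d + k))\<bar> \<le> 1" if \<omega>: "\<omega> \<in> K" for \<omega> r d
    proof -
      have "(\<Sum>k\<in>S r. \<omega> (\<sigma> (d + k))) \<le> (\<Sum>k<n. \<omega> (\<sigma> (d + k)))"
        by (rule sum_mono2) (use S \<sigma>_nonneg \<omega> in auto)
      also have "\<dots> = \<omega> (t d) - \<omega> (t (d + n))"
        using sum_lessThan_telescope'[of "\<lambda>k. \<omega> (t (d + k))" n] \<omega> by (simp add: \<sigma>)
      also have "\<dots> \<le> 1" using t(2)[OF \<omega>] by auto
      finally show ?thesis using sum_nonneg[of "S r" "\<lambda>k. \<omega> (\<sigma> (d + k))"] \<sigma>_nonneg[OF \<omega>] by simp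
    qed
    have block: "(\<Sum>k\<in>S r. b (\<sigma> (d + k)) (\<mu> (d' + k))) \<in> B" if d: "d \<le> 1" "d' \<le> 1" for r d d'
    proof -
      \<comment> \<open>Distinct \<open>k\<close> and \<open>l\<close> in one class differ by at
        least 3, hence \<open>d + k\<close> and \<open>d' + l\<close> by at least 2, and each hat
        reaches less than 1 to either side of its index. This lets the double sum below collapse to
        its diagonal.\<close>
      have off: "b (\<sigma> (d + k)) (\<mu> (d' + l)) = 0" if kl: "k \<in> S r" "l \<in> S r" "k \<noteq> l" for k l
      proof (intro b_disj disjI)
        fix \<omega> assume \<omega>: "\<omega> \<in> K" and "\<omega> (\<sigma> (d + k)) \<noteq> 0"
        note * = \<sigma>_support[OF this]
        have "\<omega> (\<sigma> (d' + l)) = 0"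
        proof (rule ccontr)
          assume "\<omega> (\<sigma> (d' + l)) \<noteq> 0"
          note ** = \<sigma>_support[OF \<omega> this]
          from apart[OF kl(1,2)] kl(3) consider "k + 3 \<le> l" | "l + 3 \<le> k" by auto
          then show False
          proof cases
            case 1
            then have "real k + 3 \<le> real l" by linarith
            then show False using * ** d by simp
          next
            case 2
            then have "real l + 3 \<le> real k" by linarith
            then show False using * ** d by simp
          qed
        qed
        then show "\<omega> (\<mu> (d' + l)) = 0" using \<mu>(2)[OF \<omega>] by simp
      qed (use \<sigma> \<mu> in auto)
      have "b (\<Sum>k\<in>S r. \<sigma> (d + k)) (\<Sum>l\<in>S r. \<mu> (d' + l))
          = (\<Sum>l\<in>S r. \<Sum>k\<in>S r. b (\<sigma> (d + k)) (\<mu> (d' + l)))"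
        by (simp only: b_lin)
      also have "\<dots> = (\<Sum>l\<in>S r. \<Sum>k\<in>S r. if k = l then b (\<sigma> (d + k)) (\<mu> (d' + l)) else 0)"
        by (intro sum.cong refl) (use off in auto)
      also have "\<dots> = (\<Sum>k\<in>S r. b (\<sigma> (d + k)) (\<mu> (d' + k)))"
        using S(1) by simp
      finally have "(\<Sum>k\<in>S r. b (\<sigma> (d + k)) (\<mu> (d' + k)))
          = b (\<Sum>k\<in>S r. \<sigma> (d + k)) (\<Sum>l\<in>S r. \<mu> (d' + l))" ..
      also have "\<dots> \<in> B"
      proof (rule bB)
        fix \<omega> assume \<omega>: "\<omega> \<in> K"
        show "\<bar>\<omega> (\<Sum>k\<in>S r. \<sigma> (d + k))\<bar> \<le> c"
          using \<sigma>_sum[OF \<omega>, of d r] c(1) by (simp add: K_sum \<omega> \<sigma>(1))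
        have "\<omega> (\<Sum>l\<in>S r. \<mu> (d' + l)) = (\<Sum>l\<in>S r. \<omega> (\<sigma> (d' + l))) * \<omega> v"
          by (simp add: K_sum \<omega> \<mu> sum_distrib_right)
        also have "\<bar>\<dots>\<bar> \<le> 1 * \<bar>\<omega> v\<bar>"
          unfolding abs_mult by (rule mult_right_mono[OF \<sigma>_sum[OF \<omega>]]) simp
        also have "\<dots> \<le> c" using c(2)[of v \<omega>] \<omega> by simp
        finally show "\<bar>\<omega> (\<Sum>l\<in>S r. \<mu> (d' + l))\<bar> \<le> c" .
      qed (use \<sigma> \<mu> in \<open>auto intro!: sum_closed\<close>)
      finally show ?thesis .
    qed
    have "real n *\<^sub>R (b u v - b e (mult u v)) = b (real n *\<^sub>R u) v - b e (real n *\<^sub>R mult u v)"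
      by (simp add: b_lin scaleR_diff_right)
    also have "\<dots> = (\<Sum>k<n. b (t (Suc k)) v - b e (m (Suc k)))"
      unfolding u_sum uv_sum by (simp add: b_lin sum_subtractf)
    also have "\<dots> = (\<Sum>k<n. b (\<sigma> (1 + k)) (\<mu> (0 + k))) + (\<Sum>k<n. - b (\<sigma> (0 + k)) (\<mu> (1 + k)))"
      unfolding step by (simp add: sum_subtractf sum_negf)
    also have "\<dots> = (\<Sum>r\<le>2. 1 *\<^sub>R (\<Sum>k\<in>S r. b (\<sigma> (1 + k)) (\<mu> (0 + k)))) +
        (\<Sum>r\<le>2. (- 1) *\<^sub>R (\<Sum>k\<in>S r. b (\<sigma> (0 + k)) (\<mu> (1 + k))))"
      unfolding split by (simp add: sum_negf)
    finally have eq: "real n *\<^sub>R (b u v - b e (mult u v)) = \<dots>" .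
    have plus: "(\<Sum>r\<le>2. 1 *\<^sub>R (\<Sum>k\<in>S r. b (\<sigma> (1 + k)) (\<mu> (0 + k)))) \<in> ?C 1"
      unfolding mem_Collect_eq
      by (rule exI[of _ "\<lambda>r. \<Sum>k\<in>S r. b (\<sigma> (1 + k)) (\<mu> (0 + k))"], intro conjI refl allI impI block)
        simp_all
    have minus: "(\<Sum>r\<le>2. (- 1) *\<^sub>R (\<Sum>k\<in>S r. b (\<sigma> (0 + k)) (\<mu> (1 + k)))) \<in> ?C (- 1)"
      unfolding mem_Collect_eq
      by (rule exI[of _ "\<lambda>r. \<Sum>k\<in>S r. b (\<sigma> (0 + k)) (\<mu> (1 + k))"], intro conjI refl allI impI block)
        simp_all
    show ?thesis unfolding eq by (rule CollectI, intro exI conjI, rule refl, rule plus, rule minus)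
  qed
  then have "b u v - b e (mult u v) = 0"
    by (rule separated_multiples_zero[OF bornology separated B'])
  then show ?thesis unfolding b_def by simp
qed

text \<open>An affine change of \<open>u\<close> brings its values into the unit interval. The
  multiple of \<open>e\<close> that it adds is harmless, because the exchange is trivial for
  \<open>u = e\<close>.\<close>

lemma form_transfer:
  assumes u: "u \<in> A" and v: "v \<in> A" and zs: "set zs \<subseteq> A" "length zs + 2 = s"
  shows "T (u # v # zs) = T (e # mult u v # zs)"
proof -
  obtain c where c: "0 \<le> c" "\<And>\<omega>. \<omega> \<in> K \<Longrightarrow> \<bar>\<omega> u\<bar> \<le> c" using K_bound[OF u] by blast
  define d where "d = c + 1"
  define u' where "u' = (1 / (2 * d)) *\<^sub>R (u + d *\<^sub>R e)"
  have d: "0 < d" using c unfolding d_def by simp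
  have u': "u' \<in> A" "\<And>\<omega>. \<omega> \<in> K \<Longrightarrow> \<omega> u' = (\<omega> u + d) / (2 * d)"
    unfolding u'_def using u unit_closed by (auto simp: closed K_hom)
  have "0 \<le> \<omega> u' \<and> \<omega> u' \<le> 1" if "\<omega> \<in> K" for \<omega>
  proof -
    have "0 \<le> \<omega> u + d" "\<omega> u + d \<le> 2 * d"
      using abs_le_D1[OF c(2)[OF that]] abs_le_D2[OF c(2)[OF that]] unfolding d_def by simp_all
    then show ?thesis using u'(2)[OF that] d by simp
  qed
  then have *: "T (u' # v # zs) = T (e # mult u' v # zs)"
    by (rule form_transfer_unit_interval[OF u'(1) _ v zs])
  have u_eq: "u = (2 * d) *\<^sub>R u' + (- d) *\<^sub>R e" unfolding u'_def using d by simp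
  have uv_eq: "mult u v = (2 * d) *\<^sub>R mult u' v + (- d) *\<^sub>R v"
  proof (subst eq_iff_K; (intro ballI closed(2,3) mult_closed u v u'(1))?)
    fix \<omega> assume \<omega>: "\<omega> \<in> K"
    have "\<omega> u = 2 * d * \<omega> u' - d" using u'(2)[OF \<omega>] d by simp
    then show "\<omega> (mult u v) = \<omega> ((2 * d) *\<^sub>R mult u' v + (- d) *\<^sub>R v)"
      using \<omega> u v u'(1) by (simp add: closed mult_closed K_hom K_mult left_diff_distrib)
  qed
  interpret l1: linear "\<lambda>x. T (x # v # zs)"
    using symmetric_multilinear_linear[OF T, of "[]" "v # zs"] zs by simp
  interpret l2: linear "\<lambda>x. T (e # x # zs)"
    using symmetric_multilinear_linear[OF T, of "[e]" zs] zs by simp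
  have "T (u # v # zs) = (2 * d) *\<^sub>R T (u' # v # zs) + (- d) *\<^sub>R T (e # v # zs)"
    by (subst u_eq) (simp only: l1.add l1.scale)
  also have "\<dots> = T (e # mult u v # zs)"
    by (subst uv_eq) (simp only: l2.add l2.scale *)
  finally show ?thesis .
qed

text \<open>Each exchange merges two entries into their product and frees one place for
  \<open>e\<close>.\<close>

lemma form_eq_product:
  assumes "length xs + k = s" "xs \<noteq> []" "set xs \<subseteq> A"
  shows "\<exists>z\<in>A. (\<forall>\<omega>\<in>K. \<omega> z = prod_list (map \<omega> xs)) \<and>
    T (xs @ replicate k e) = T (z # replicate (s - 1) e)"
  using assms
proof (induction "length xs" arbitrary: xs k rule: less_induct)
  case less
  obtain x ys where xs: "xs = x # ys" using less.prems by (cases xs) auto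
  show ?case
  proof (cases ys)
    case Nil
    then show ?thesis using less.prems xs by (intro bexI[of _ x]) auto
  next
    case (Cons y ws)
    have in_A: "x \<in> A" "y \<in> A" "set ws \<subseteq> A" using less.prems xs Cons by auto
    have "set (ws @ replicate k e) \<subseteq> A" using in_A unit_closed by auto
    then have "T (xs @ replicate k e) = T (e # mult x y # ws @ replicate k e)"
      unfolding xs Cons using form_transfer[of x y "ws @ replicate k e"] in_A less.prems xs Cons
      by auto
    also have "\<dots> = T ((mult x y # ws) @ replicate (Suc k) e)"
      by (rule symmetric_multilinear_mset[OF T]) (use less.prems xs Cons in auto)
    finally have *: "T (xs @ replicate k e) = T ((mult x y # ws) @ replicate (Suc k) e)" .
    obtain z where "z \<in> A" "\<forall>\<omega>\<in>K. \<omega> z = prod_list (map \<omega> (mult x y # ws))"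
      "T ((mult x y # ws) @ replicate (Suc k) e) = T (z # replicate (s - 1) e)"
      using less.hyps[of "mult x y # ws" "Suc k"] less.prems xs Cons in_A by (auto simp: mult_closed)
    then show ?thesis using * in_A xs Cons
      by (intro bexI[of _ z]) (auto simp: K_mult mult.assoc)
  qed
qed

lemma form_eqI:
  assumes "length xs = s" "length ys = s" "set xs \<subseteq> A" "set ys \<subseteq> A"
    and "\<And>\<omega>. \<omega> \<in> K \<Longrightarrow> prod_list (map \<omega> xs) = prod_list (map \<omega> ys)"
  shows "T xs = T ys"
proof -
  have ne: "xs \<noteq> []" "ys \<noteq> []" using assms degree by auto
  obtain x where x: "x \<in> A" "\<forall>\<omega>\<in>K. \<omega> x = prod_list (map \<omega> xs)" "T xs = T (x # replicate (s - 1) e)"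
    using form_eq_product[of xs 0] assms ne by auto
  obtain y where y: "y \<in> A" "\<forall>\<omega>\<in>K. \<omega> y = prod_list (map \<omega> ys)" "T ys = T (y # replicate (s - 1) e)"
    using form_eq_product[of ys 0] assms ne by auto
  have "x = y" using x y assms(5) by (subst eq_iff_K) auto
  then show ?thesis using x(3) y(3) by simp
qed

end

section \<open>Geometric means\<close>

lemma vector_sublattice_hull: "vector_sublattice (vector_sublattice hull S)"
proof (rule hull_in)
  fix F :: "'a set set"
  assume "Ball F vector_sublattice"
  then show "vector_sublattice (\<Inter>F)"
    unfolding vector_sublattice_def by (auto intro!: subspace_Inter)
qed

lemma principal_ideal_absI: "\<bar>x\<bar> \<le> e \<Longrightarrow> x \<in> principal_ideal e"
  unfolding principal_ideal_def
  by (intro CollectI exI[of _ 1]) (simp, metis abs_le_D1 abs_le_D2 minus_le_iff)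

lemma member_le_sum_list_nonneg:
  fixes x :: "'a::ordered_ab_group_add"
  assumes "\<forall>y\<in>set xs. 0 \<le> y" "x \<in> set xs"
  shows "x \<le> sum_list xs"
  using assms
proof (induction xs)
  case (Cons y ys)
  have "0 \<le> sum_list ys" using Cons.prems(1) by (intro sum_list_nonneg) auto
  then show ?case
    using Cons by (cases "x = y") (auto simp: add_increasing add_increasing2)
qed simp

text \<open>Both candidates and all of \<open>fs\<close> lie in one ideal, and every
  \<open>\<omega> \<in> K\<close> restricts to each of the two sublattices on which the candidates
  are tested. So the candidates agree on \<open>K\<close>.\<close>

lemma functional_calculus_value_unique:
  fixes g g' :: "'a::uniformly_complete_vector_lattice"
  assumes "functional_calculus_value h fs g" "functional_calculus_value h fs g'"
  shows "g = g'"
proof -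
  let ?xs = "map abs (g # g' # fs)"
  define e where "e = sum_list ?xs"
  have e: "0 \<le> e" unfolding e_def by (rule sum_list_nonneg) auto
  interpret order_unit e by unfold_locales (rule e)
  have A: "x \<in> A" if "x \<in> set (g # g' # fs)" for x
    by (rule principal_ideal_absI, unfold e_def, rule member_le_sum_list_nonneg) (use that in auto)
  have "\<omega> k = h (map \<omega> fs)" if "functional_calculus_value h fs k" "k \<in> A" "\<omega> \<in> K" for k \<omega>
  proof -
    have "vector_sublattice hull (insert k (set fs)) \<subseteq> A"
      by (rule hull_minimal) (use that A vector_sublattice_principal_ideal[OF e] in auto)
    then have "real_lattice_hom_on (vector_sublattice hull (insert k (set fs))) \<omega>"
      using real_lattice_hom_on_subset that(3) unfolding K_def by blast
    then show ?thesis using that(1) unfolding functional_calculus_value_def by blast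
  qed
  from this[OF assms(1)] this[OF assms(2)] show ?thesis using A by (subst eq_iff_K) simp_all
qed

lemma functional_calculus_eqI:
  fixes g :: "'a::uniformly_complete_vector_lattice"
  assumes "functional_calculus_value h fs g"
  shows "functional_calculus h fs = g"
  unfolding functional_calculus_def
  using assms functional_calculus_value_unique[OF _ assms] by (rule the_equality)

section \<open>Lists with multiplicities and geometric means of real numbers\<close>

lemma concat_map2_replicate_map:
  "concat (map2 replicate r (map \<omega> fs)) = map \<omega> (concat (map2 replicate r fs))"
proof (induction r arbitrary: fs)
  case (Cons k r)
  then show ?case by (cases fs) auto
qed simp

lemma set_concat_map2_replicate: "set (concat (map2 replicate r fs)) \<subseteq> set fs"
  by (auto dest: set_zip_rightD)

lemma length_concat_map2_replicate:
  "length r = length fs \<Longrightarrow> length (concat (map2 replicate r fs)) = (\<Sum>k<length r. r ! k)"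
proof (induction r fs rule: list_induct2)
  case (Cons k r f fs)
  then show ?case by (simp add: sum.lessThan_Suc_shift del: sum.lessThan_Suc)
qed simp

lemma prod_list_concat_map2_replicate:
  fixes xs :: "real list"
  shows "length r = length xs \<Longrightarrow>
    prod_list (concat (map2 replicate r xs)) = (\<Prod>k<length r. xs ! k ^ (r ! k))"
proof (induction r xs rule: list_induct2)
  case (Cons k r x xs)
  then show ?case
    by (simp add: prod.lessThan_Suc_shift prod_list_replicate del: prod.lessThan_Suc)
qed simp

lemma weighted_geometric_mean_nonneg: "0 \<le> weighted_geometric_mean t x"
  unfolding weighted_geometric_mean_def by (intro prod_nonneg) auto

lemma weighted_geometric_mean_power:
  assumes "length r = length xs" "0 < s" "\<forall>k<length r. 1 \<le> r ! k" "\<forall>x\<in>set xs. 0 \<le> x"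
  shows "weighted_geometric_mean (map (\<lambda>k. real k / real s) r) xs ^ s
    = prod_list (concat (map2 replicate r xs))"
proof -
  have "(\<bar>xs ! k\<bar> powr (real (r ! k) / real s)) ^ s = xs ! k ^ (r ! k)" if k: "k < length r" for k
  proof (cases "xs ! k = 0")
    \<comment> \<open>Here \<open>0 powr t = 0\<close> on the left, and \<open>1 \<le> r ! k\<close>
      makes the power on the right 0 instead of 1.\<close>
    case True
    then show ?thesis using assms k by (auto simp: power_0_left)
  next
    case False
    moreover have "0 \<le> xs ! k" using assms k by simp
    ultimately have "0 < xs ! k" by simp
    then show ?thesis using assms(2)
      by (simp add: powr_realpow[symmetric] powr_powr)
  qed
  then show ?thesis
    unfolding weighted_geometric_mean_def prod_list_concat_map2_replicate[OF assms(1)] prod_power_distrib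
    by (intro prod.cong) auto
qed

text \<open>Recognizes the mean by its \<open>s\<close>-th power, a product without real
  exponents.\<close>

lemma weighted_geometric_mean_eqI:
  assumes "length r = length xs" "0 < s" "\<forall>k<length r. 1 \<le> r ! k" "\<forall>x\<in>set xs. 0 \<le> x"
    and "0 \<le> y" "y ^ s = prod_list (concat (map2 replicate r xs))"
  shows "weighted_geometric_mean (map (\<lambda>k. real k / real s) r) xs = y"
proof (rule power_eq_imp_eq_base)
  show "weighted_geometric_mean (map (\<lambda>k. real k / real s) r) xs ^ s = y ^ s"
    unfolding assms(6) by (rule weighted_geometric_mean_power[OF assms(1-4)])
qed (use assms weighted_geometric_mean_nonneg in simp_all)

context order_unit
begin

lemma product_exists:
  "set xs \<subseteq> A \<Longrightarrow> \<exists>z\<in>A. \<forall>\<omega>\<in>K. \<omega> z = prod_list (map \<omega> xs)"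
proof (induction xs)
  case Nil
  then show ?case using unit_closed by (intro bexI[of _ e]) (auto simp: K_hom)
next
  case (Cons x xs)
  then obtain z where "z \<in> A" "\<forall>\<omega>\<in>K. \<omega> z = prod_list (map \<omega> xs)" by auto
  then show ?case using Cons.prems by (intro bexI[of _ "mult x z"]) (auto simp: mult_closed K_mult)
qed

lemma root_product_exists:
  assumes "set xs \<subseteq> A" "\<forall>x\<in>set xs. 0 \<le> x" "0 < n"
  shows "\<exists>g\<in>A. \<forall>\<omega>\<in>K. 0 \<le> \<omega> g \<and> \<omega> g ^ n = prod_list (map \<omega> xs)"
proof -
  obtain z where z: "z \<in> A" "\<forall>\<omega>\<in>K. \<omega> z = prod_list (map \<omega> xs)"
    using product_exists[OF assms(1)] by blast
  have cont: "continuous_on UNIV (\<lambda>t. root n \<bar>t\<bar>)" by (intro continuous_intros)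
  have "0 \<le> \<omega> z" if \<omega>: "\<omega> \<in> K" for \<omega>
  proof -
    have "0 \<le> \<omega> x" if "x \<in> set xs" for x
      using le_iff_K[of 0 x] that assms(1,2) \<omega> by (auto simp: closed K_hom subset_iff)
    then have "0 \<le> prod_list (map \<omega> xs)" by (intro prod_list_nonneg) auto
    then show ?thesis using z(2) \<omega> by simp
  qed
  then have root: "\<omega> (apply_fun (\<lambda>t. root n \<bar>t\<bar>) z) = root n (prod_list (map \<omega> xs))"
    "0 \<le> prod_list (map \<omega> xs)" if "\<omega> \<in> K" for \<omega>
    using apply_fun(2)[OF cont z(1) that] z(2) that by auto
  then show ?thesis using apply_fun(1)[OF cont z(1)] assms(3)
  proof (intro bexI[of _ "apply_fun (\<lambda>t. root n \<bar>t\<bar>) z"] ballI)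
    fix \<omega> assume "\<omega> \<in> K"
    note * = root[OF this]
    show "0 \<le> \<omega> (apply_fun (\<lambda>t. root n \<bar>t\<bar>) z) \<and>
        \<omega> (apply_fun (\<lambda>t. root n \<bar>t\<bar>) z) ^ n = prod_list (map \<omega> xs)"
      unfolding *(1) using *(2) assms(3) by simp
  qed
qed

end

text \<open>\<open>g\<close> is described by homomorphisms of the ideal, but the calculus asks about
  every homomorphism \<open>\<omega>\<close> of the sublattice \<open>?M\<close>. If
  \<open>\<omega> e = 0\<close>, then \<open>\<omega>\<close> vanishes on \<open>?M\<close> and both
  sides are 0. Otherwise \<open>\<omega>\<close> divided by \<open>\<omega> e\<close> extends to the
  ideal, and homogeneity of degree \<open>s\<close> restores the factor.\<close>

lemma partitioned_geometric_mean_eqI: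
  fixes fs :: "'a::uniformly_complete_vector_lattice list"
  assumes r: "length r = length fs" "\<forall>k<length r. 1 \<le> r ! k" "(\<Sum>k<length r. r ! k) = s" "0 < s"
    and fs: "\<forall>f\<in>set fs. 0 \<le> f"
    and g: "g \<in> principal_ideal (sum_list fs)"
      "\<forall>\<omega>\<in>order_unit.K (sum_list fs). 0 \<le> \<omega> g \<and> \<omega> g ^ s = prod_list (map \<omega> (concat (map2 replicate r fs)))"
  shows "partitioned_geometric_mean s r fs = g"
  unfolding partitioned_geometric_mean_def
proof (rule functional_calculus_eqI, unfold functional_calculus_value_def, intro allI impI)
  fix \<omega>
  define e where "e = sum_list fs"
  let ?M = "vector_sublattice hull insert g (set fs)"
  assume \<omega>: "real_lattice_hom_on ?M \<omega>"
  note hom = real_lattice_hom_onD[OF \<omega>] and mono = real_lattice_hom_on_mono[OF \<omega>]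
  note M = vector_sublattice_hull[of "insert g (set fs)"]
  note closed_M = vector_sublatticeD[OF M]
  have e: "0 \<le> e" unfolding e_def using fs by (intro sum_list_nonneg) auto
  interpret order_unit e by unfold_locales (rule e)
  define L where "L = concat (map2 replicate r fs)"
  have gens: "g \<in> ?M" "set fs \<subseteq> ?M" using hull_subset[of "insert g (set fs)" vector_sublattice] by auto
  have "sum_list xs \<in> ?M" if "set xs \<subseteq> ?M" for xs
    using that by (induction xs) (auto intro: closed_M)
  then have eM: "e \<in> ?M" unfolding e_def using gens(2) .
  have fA: "f \<in> A" if "f \<in> set fs" for f
    by (rule principal_ideal_absI) (use that fs member_le_sum_list_nonneg in \<open>auto simp: e_def\<close>)
  have MA: "?M \<subseteq> A"
    by (rule hull_minimal) (use g fA vector_sublattice_principal_ideal[OF e] in \<open>auto simp: e_def\<close>)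
  have zero: "\<omega> 0 = 0" using hom(2)[OF closed_M(1), of 0] by simp
  have \<omega>f: "0 \<le> \<omega> f" if "f \<in> set fs" for f
    using mono[of 0 f] closed_M(1) gens(2) that fs zero by auto
  have L: "length L = s" "set L \<subseteq> set fs"
    unfolding L_def length_concat_map2_replicate[OF r(1)] by (rule r(3), rule set_concat_map2_replicate)
  have "0 \<le> \<omega> g \<and> \<omega> g ^ s = prod_list (map \<omega> L)"
  proof (cases "\<omega> e = 0")
    case True
    have zero_M: "\<omega> x = 0" if x: "x \<in> ?M" for x
    proof -
      have "x \<in> A" using MA x by blast
      then obtain c where c: "0 \<le> c" "- (c *\<^sub>R e) \<le> x" "x \<le> c *\<^sub>R e" by (rule principal_idealE)
      have "\<omega> (c *\<^sub>R e) = 0" "\<omega> (- (c *\<^sub>R e)) = 0"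
        using True hom(2,5) closed_M(3) eM by auto
      then show ?thesis
        using mono[OF _ x c(2)] mono[OF x _ c(3)] closed_M(3,4) eM by fastforce
    qed
    \<comment> \<open>Since \<open>s > 0\<close>, the list is nonempty and its product has a zero
      factor; an empty product would be 1.\<close>
    have "hd L \<in> set L" using L(1) r(4) by (intro hd_in_set) auto
    then have "0 \<in> set (map \<omega> L)" using zero_M[of "hd L"] L(2) gens(2) by (force simp: image_iff)
    then have "prod_list (map \<omega> L) = 0" by (simp add: prod_list_zero_iff)
    then show ?thesis using zero_M[OF gens(1)] r(4) by (simp add: power_0_left)
  next
    case False
    then have pos: "0 < \<omega> e" using mono[OF closed_M(1) eM e] zero by simp
    define \<omega>1 where "\<omega>1 x = \<omega> x / \<omega> e" for x
    have "real_lattice_hom_on ?M \<omega>1"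
      unfolding real_lattice_hom_on_def \<omega>1_def using pos
      by (auto simp: hom add_divide_distrib max_divide_distrib_right min_divide_distrib_right)
    then obtain \<omega>' where \<omega>': "real_lattice_hom_on A \<omega>'" "\<And>x. x \<in> ?M \<Longrightarrow> \<omega>' x = \<omega>1 x"
      using real_lattice_hom_extension[OF e M eM MA] by blast
    have "\<omega>' \<in> K" unfolding K_def using \<omega>' eM pos by (simp add: \<omega>1_def)
    then have g': "0 \<le> \<omega>' g" "\<omega>' g ^ s = prod_list (map \<omega>' L)"
      using g(2) unfolding e_def L_def by auto
    have map_eq: "map \<omega>' L = map \<omega>1 L" using \<omega>'(2) L(2) gens(2) by (intro map_cong) auto
    have "prod_list (map \<omega>1 xs) * \<omega> e ^ length xs = prod_list (map \<omega> xs)" for xs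
    proof (induction xs)
      case (Cons x xs)
      have "\<omega>1 x * \<omega> e = \<omega> x" using pos by (simp add: \<omega>1_def)
      then show ?case by (simp add: Cons.IH[symmetric])
    qed simp
    from this[of L] have "prod_list (map \<omega>' L) * \<omega> e ^ s = prod_list (map \<omega> L)"
      unfolding map_eq L(1) .
    moreover have "\<omega> g = \<omega>' g * \<omega> e" using \<omega>'(2)[OF gens(1)] pos by (simp add: \<omega>1_def)
    ultimately show ?thesis using g' pos by (simp add: power_mult_distrib)
  qed
  then have "weighted_geometric_mean (map (\<lambda>k. real k / real s) r) (map \<omega> fs) = \<omega> g"
    using r \<omega>f by (intro weighted_geometric_mean_eqI) (auto simp: concat_map2_replicate_map L_def)
  then show "\<omega> g = weighted_geometric_mean (map (\<lambda>k. real k / real s) r) (map \<omega> fs)" ..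
qed

section \<open>The characterization\<close>

lemma partitioned_geometric_mean_formula:
  fixes P :: "'a::uniformly_complete_vector_lattice \<Rightarrow> 'b::real_vector"
  assumes s: "2 \<le> s" and \<B>: "convex_bornology \<B>" "separated_bornology \<B>"
    and P: "homogeneous_polynomial_with s P T" "bounded_map P \<B>" "orthogonally_additive P"
    and r: "length r = length fs" "\<forall>k<length r. 1 \<le> r ! k" "(\<Sum>k<length r. r ! k) = s"
    and fs: "\<forall>f\<in>set fs. 0 \<le> f"
  shows "P (partitioned_geometric_mean s r fs) = T (concat (map2 replicate r fs))"
proof -
  define e where "e = sum_list fs"
  have e: "0 \<le> e" unfolding e_def using fs by (intro sum_list_nonneg) auto
  interpret orthogonally_additive_form e s P T \<B>
    by unfold_locales (use e s \<B> P in \<open>auto simp: homogeneous_polynomial_with_def\<close>)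
  let ?L = "concat (map2 replicate r fs)"
  have fA: "f \<in> A" if "f \<in> set fs" for f
    by (rule principal_ideal_absI) (use that fs member_le_sum_list_nonneg in \<open>auto simp: e_def\<close>)
  have L: "length ?L = s" "set ?L \<subseteq> set fs"
    unfolding length_concat_map2_replicate[OF r(1)] by (rule r(3), rule set_concat_map2_replicate)
  have "\<exists>g\<in>A. \<forall>\<omega>\<in>K. 0 \<le> \<omega> g \<and> \<omega> g ^ s = prod_list (map \<omega> ?L)"
    by (rule root_product_exists) (use L(2) fA fs s in \<open>auto simp: subset_iff\<close>)
  then obtain g where g: "g \<in> A" "\<forall>\<omega>\<in>K. 0 \<le> \<omega> g \<and> \<omega> g ^ s = prod_list (map \<omega> ?L)"
    by (rule bexE)
  have "partitioned_geometric_mean s r fs = g"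
    by (rule partitioned_geometric_mean_eqI[OF r _ fs]) (use s g in \<open>auto simp: e_def\<close>)
  moreover have "P g = T ?L"
    unfolding P_eq
    by (rule form_eqI) (use L g fA in \<open>auto simp: prod_list_replicate\<close>)
  ultimately show ?thesis by simp
qed

section \<open>From the formula for means back to orthogonal additivity\<close>

lemma symmetric_multilinear_zero_entry:
  assumes "symmetric_multilinear s T" "0 \<in> set xs" "length xs = s"
  shows "T xs = 0"
proof -
  obtain ys zs where xs: "xs = ys @ 0 # zs" using assms(2) by (meson split_list)
  show ?thesis unfolding xs
    by (rule linear_0[OF symmetric_multilinear_linear[OF assms(1)]]) (use xs assms(3) in simp)
qed

lemma mset_concat_map2_replicate:
  "length r = length fs \<Longrightarrow>
    mset (concat (map2 replicate r fs)) = (\<Sum>k<length r. replicate_mset (r ! k) (fs ! k))"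
proof (induction r fs rule: list_induct2)
  case (Cons k r f fs)
  then show ?case by (simp add: sum.lessThan_Suc_shift del: sum.lessThan_Suc)
qed simp

lemma sum_replicate_mset: "(\<Sum>k<n. replicate_mset (h k) x) = replicate_mset (\<Sum>k<(n::nat). h k) x"
  by (induction n) (auto simp: multiset_eq_iff)

text \<open>Write \<open>q\<close> as a subsum of the \<open>r ! k\<close> and put \<open>f\<close>
  in the chosen places, \<open>g\<close> in the others. As \<open>0 < q < s\<close>, both occur. A
  real homomorphism kills \<open>f\<close> or \<open>g\<close>, hence a factor of the mean, while
  the list on the other side of the formula contains \<open>f\<close> exactly \<open>q\<close>
  times.\<close>

lemma geometric_mean_formula_imp_disjoint_zero:
  fixes P :: "'a::uniformly_complete_vector_lattice \<Rightarrow> 'b::real_vector"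
  assumes P: "homogeneous_polynomial_with s P T" and r: "complete_partition s r"
    and formula: "\<And>fs. length fs = length r \<Longrightarrow> (\<forall>f\<in>set fs. 0 \<le> f) \<Longrightarrow>
      P (partitioned_geometric_mean s r fs) = T (concat (map2 replicate r fs))"
    and fg: "0 \<le> f" "0 \<le> g" "inf f g = 0" and q: "0 < q" "q < s"
  shows "T (replicate q f @ replicate (s - q) g) = 0"
proof -
  have T: "symmetric_multilinear s T" and P_eq: "\<And>f. P f = T (replicate s f)"
    using P unfolding homogeneous_polynomial_with_def by auto
  have r1: "\<forall>k<length r. 1 \<le> r ! k" and r_sum: "(\<Sum>k<length r. r ! k) = s"
    using r unfolding complete_partition_def by auto
  obtain \<alpha> where \<alpha>: "\<forall>k<length r. \<alpha> k \<in> {0, 1}" "q = (\<Sum>k<length r. \<alpha> k * r ! k)"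
  proof -
    have "q \<in> {1..s}" using q by simp
    with r have "\<exists>\<alpha>. (\<forall>k<length r. \<alpha> k \<in> {0, 1}) \<and> q = (\<Sum>k<length r. \<alpha> k * r ! k)"
      unfolding complete_partition_def by (elim conjE) (rule bspec)
    then show thesis using that by (elim exE conjE)
  qed
  define fs where "fs = map (\<lambda>k. if \<alpha> k = 1 then f else g) [0..<length r]"
  have len: "length fs = length r" and nth: "\<And>k. k < length r \<Longrightarrow> fs ! k = (if \<alpha> k = 1 then f else g)"
    unfolding fs_def by auto
  obtain k where k: "k < length r" "\<alpha> k = 1"
  proof -
    have "\<exists>k<length r. \<alpha> k \<noteq> 0"
    proof (rule ccontr)
      assume "\<not> (\<exists>k<length r. \<alpha> k \<noteq> 0)"
      then have "q = 0" unfolding \<alpha>(2) by (intro sum.neutral) auto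
      then show False using q by simp
    qed
    then show thesis using that \<alpha>(1) by auto
  qed
  obtain l where l: "l < length r" "\<alpha> l = 0"
  proof -
    have "\<exists>l<length r. \<alpha> l \<noteq> 1"
    proof (rule ccontr)
      assume "\<not> (\<exists>l<length r. \<alpha> l \<noteq> 1)"
      then have "q = s" unfolding \<alpha>(2) r_sum[symmetric] by (intro sum.cong) auto
      then show False using q by simp
    qed
    then show thesis using that \<alpha>(1) by auto
  qed
  have "functional_calculus_value (weighted_geometric_mean (map (\<lambda>k. real k / real s) r)) fs 0"
    unfolding functional_calculus_value_def
  proof (intro allI impI)
    fix \<omega> assume \<omega>: "real_lattice_hom_on (vector_sublattice hull insert 0 (set fs)) \<omega>"
    have "set fs \<subseteq> vector_sublattice hull insert 0 (set fs)"
      using hull_subset[of "insert 0 (set fs)" vector_sublattice] by auto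
    moreover have "f \<in> set fs" "g \<in> set fs"
      using nth_mem[of k fs] nth_mem[of l fs] nth[of k] nth[of l] k l len by simp_all
    ultimately have M: "f \<in> vector_sublattice hull insert 0 (set fs)"
      "g \<in> vector_sublattice hull insert 0 (set fs)" by auto
    have zero: "\<omega> 0 = 0" using real_lattice_hom_onD(2)[OF \<omega> M(1), of 0] by simp
    have "min (\<omega> f) (\<omega> g) = 0" using real_lattice_hom_onD(4)[OF \<omega> M] fg zero by simp
    then have "\<omega> (fs ! k) = 0 \<or> \<omega> (fs ! l) = 0" using nth k l by (auto simp: min_def split: if_splits)
    then obtain i where i: "i < length r" "\<omega> (fs ! i) = 0" using k l by blast
    have "(\<Prod>k<length r. \<bar>map \<omega> fs ! k\<bar> powr (real (r ! k) / real s)) = 0"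
      by (rule prod_zero) (use i len in auto)
    then show "\<omega> 0 = weighted_geometric_mean (map (\<lambda>k. real k / real s) r) (map \<omega> fs)"
      unfolding weighted_geometric_mean_def zero by (simp cong: prod.cong_simp)
  qed
  then have mean: "partitioned_geometric_mean s r fs = 0"
    unfolding partitioned_geometric_mean_def by (rule functional_calculus_eqI)
  have "P 0 = 0"
    unfolding P_eq by (rule symmetric_multilinear_zero_entry[OF T]) (use q in auto)
  then have L0: "T (concat (map2 replicate r fs)) = 0"
    using formula[OF len] mean fg by (auto simp: fs_def)
  have part: "replicate_mset (r ! k) (fs ! k) =
      replicate_mset (\<alpha> k * r ! k) f + replicate_mset (r ! k - \<alpha> k * r ! k) g" if "k < length r" for k
    using nth[OF that] \<alpha>(1) that by auto
  have "(\<Sum>k<length r. r ! k - \<alpha> k * r ! k) = s - q"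
    unfolding r_sum[symmetric] \<alpha>(2) by (rule sum_subtractf_nat) (use \<alpha>(1) in auto)
  then have "mset (concat (map2 replicate r fs)) = replicate_mset q f + replicate_mset (s - q) g"
    unfolding mset_concat_map2_replicate[OF len[symmetric]]
    by (simp add: part sum.distrib sum_replicate_mset \<alpha>(2) cong: sum.cong_simp)
  then show ?thesis
    using symmetric_multilinear_mset[OF T, of "replicate q f @ replicate (s - q) g"
      "concat (map2 replicate r fs)"] L0 q by simp
qed

text \<open>The hypothesis concerns positive elements, whereas \<open>f\<close> and \<open>g\<close>
  may have any sign. The positive and negative parts of \<open>f\<close> lie in the cone
  \<open>C f\<close>, those of \<open>g\<close> in \<open>C g\<close>, and members of the two cones
  are disjoint. Polarization within the cones gives vanishing on mixed lists; the binomial formula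
  with \<open>t = - 1\<close> then reassembles \<open>f\<close> and \<open>g\<close> from their
  parts.\<close>

lemma orthogonally_additive_if_disjoint_zero:
  fixes P :: "'a::uniformly_complete_vector_lattice \<Rightarrow> 'b::real_vector"
  assumes P: "homogeneous_polynomial_with s P T" and s: "0 < s"
    and zero: "\<And>f g q. 0 \<le> f \<Longrightarrow> 0 \<le> g \<Longrightarrow> inf f g = 0 \<Longrightarrow> 0 < q \<Longrightarrow> q < s \<Longrightarrow>
      T (replicate q f @ replicate (s - q) g) = 0"
  shows "orthogonally_additive P"
  unfolding orthogonally_additive_def
proof (intro allI impI)
  fix f g :: 'a assume fg: "inf \<bar>f\<bar> \<bar>g\<bar> = 0"
  have T: "symmetric_multilinear s T" and P_eq: "\<And>f. P f = T (replicate s f)"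
    using P unfolding homogeneous_polynomial_with_def by auto
  define e where "e = \<bar>f\<bar> + \<bar>g\<bar>"
  have e: "0 \<le> e" unfolding e_def by (simp add: add_nonneg_nonneg)
  interpret order_unit e by unfold_locales (rule e)
  have A: "f \<in> A" "g \<in> A"
    by (rule principal_ideal_absI; simp add: e_def)+
  define C where "C x = {u\<in>A. \<forall>\<omega>\<in>K. 0 \<le> \<omega> u \<and> (\<omega> x = 0 \<longrightarrow> \<omega> u = 0)}" for x
  have C_add: "u + t *\<^sub>R v \<in> C x" if "u \<in> C x" "v \<in> C x" "0 \<le> t" for u v x and t :: real
    using that unfolding C_def by (auto simp: closed K_hom)
  have C_ne: "C x \<noteq> {}" for x
  proof -
    have "0 \<in> C x" unfolding C_def by (simp add: closed K_hom)
    then show ?thesis by blast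
  qed
  have parts: "sup x 0 \<in> C x" "sup (- x) 0 \<in> C x" "x = sup x 0 + (- 1) *\<^sub>R sup (- x) 0" if "x \<in> A" for x
    using that unfolding C_def by (auto simp: closed K_hom eq_iff_K)
  have disj: "\<omega> f = 0 \<or> \<omega> g = 0" if \<omega>: "\<omega> \<in> K" for \<omega>
  proof -
    have "\<omega> (inf \<bar>f\<bar> \<bar>g\<bar>) = 0" unfolding fg using K_hom(9)[OF \<omega>] .
    then have "min \<bar>\<omega> f\<bar> \<bar>\<omega> g\<bar> = 0" using A \<omega> by (simp add: K_hom closed)
    then show ?thesis by (auto simp: min_def split: if_splits)
  qed
  have diag: "T (replicate q u @ replicate (s - q) v) = 0"
    if uv: "u \<in> C f" "v \<in> C g" and q: "0 < q" "q < s" for u v q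
  proof (rule zero[OF _ _ _ q])
    have uvA: "u \<in> A" "v \<in> A" using uv unfolding C_def by auto
    show "0 \<le> u" "0 \<le> v"
      using le_iff_K[OF closed(1) uvA(1)] le_iff_K[OF closed(1) uvA(2)] uv unfolding C_def
      by (auto simp: K_hom)
    have "min (\<omega> u) (\<omega> v) = 0" if "\<omega> \<in> K" for \<omega>
    proof -
      have "\<omega> u = 0 \<or> \<omega> v = 0" "0 \<le> \<omega> u" "0 \<le> \<omega> v"
        using disj[OF that] uv that unfolding C_def by auto
      then show ?thesis by auto
    qed
    then show "inf u v = 0" using uvA by (subst eq_iff_K) (auto simp: closed K_hom)
  qed
  have cross: "T (replicate q f @ replicate (s - q) g) = 0" if q: "0 < q" "q < s" for q
  proof -
    have 1: "T (xs @ replicate (s - q) v) = 0" if "set xs \<subseteq> C f" "length xs = q" "v \<in> C g" for xs v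
      by (rule polarization_zero[OF T, where U = "C f"]) (use that C_add C_ne diag q in auto)
    have 2: "T (ys @ xs) = 0" if "set xs \<subseteq> C f" "length xs = q" "set ys \<subseteq> C g" "length ys = s - q" for xs ys
    proof (rule polarization_zero[OF T, where U = "C g"])
      fix v assume "v \<in> C g"
      then show "T (replicate (length ys) v @ xs) = 0"
        using 1[of xs v] symmetric_multilinear_mset[OF T, of "replicate (length ys) v @ xs" "xs @ replicate (s - q) v"]
          that q by simp
    qed (use that C_add C_ne q in auto)
    have 3: "T (replicate q f @ ys) = 0" if ys: "set ys \<subseteq> C g" "length ys = s - q" for ys
    proof -
      have "T (replicate (q - i) (sup f 0) @ replicate i (sup (- f) 0) @ ys) = 0" if "i \<le> q" for i
      proof -
        let ?xs = "replicate (q - i) (sup f 0) @ replicate i (sup (- f) 0)"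
        have "set ?xs \<subseteq> C f" using parts[OF A(1)] by auto
        then have "T (ys @ ?xs) = 0" using ys that by (intro 2) auto
        then show ?thesis
          using symmetric_multilinear_mset[OF T, of "ys @ ?xs" "?xs @ ys"] ys that q by simp
      qed
      then show ?thesis
        using symmetric_multilinear_binomial[OF T, of q ys "sup f 0" "- 1" "sup (- f) 0"] ys q
          parts(3)[OF A(1)] by simp
    qed
    have "T (replicate (s - q) g @ replicate q f) = 0"
    proof -
      have "T (replicate (s - q - i) (sup g 0) @ replicate i (sup (- g) 0) @ replicate q f) = 0"
        if "i \<le> s - q" for i
      proof -
        let ?ys = "replicate (s - q - i) (sup g 0) @ replicate i (sup (- g) 0)"
        have "set ?ys \<subseteq> C g" using parts[OF A(2)] by auto
        then have "T (replicate q f @ ?ys) = 0" using that by (intro 3) auto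
        then show ?thesis
          using symmetric_multilinear_mset[OF T, of "replicate q f @ ?ys" "?ys @ replicate q f"] that q
          by simp
      qed
      then show ?thesis
        using symmetric_multilinear_binomial[OF T, of "s - q" "replicate q f" "sup g 0" "- 1" "sup (- g) 0"] q
          parts(3)[OF A(2)] by simp
    qed
    then show ?thesis
      using symmetric_multilinear_mset[OF T, of "replicate q f @ replicate (s - q) g"
        "replicate (s - q) g @ replicate q f"] q by simp
  qed
  have "P (f + g) = (\<Sum>i\<le>s. real (s choose i) *\<^sub>R T (replicate (s - i) f @ replicate i g))"
    using symmetric_multilinear_binomial[OF T, of s "[]" f 1 g] unfolding P_eq by simp
  also have "\<dots> = (\<Sum>i\<le>s. (if i = 0 then P f else 0) + (if i = s then P g else 0))"
  proof (rule sum.cong)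
    fix i assume "i \<in> {..s}"
    then consider "i = 0" | "i = s" | "0 < s - i" "s - i < s" by (cases "i = 0"; cases "i = s") auto
    then show "real (s choose i) *\<^sub>R T (replicate (s - i) f @ replicate i g)
        = (if i = 0 then P f else 0) + (if i = s then P g else 0)"
    proof cases
      case 3
      then have "i \<noteq> 0" "i \<noteq> s" by auto
      then show ?thesis using 3 cross[of "s - i"] by simp
    qed (use s in \<open>auto simp: P_eq\<close>)
  qed simp
  also have "\<dots> = P f + P g" by (simp add: sum.distrib)
  finally show "P (f + g) = P f + P g" .
qed

theorem theorem2p6:
  fixes p s :: nat
    and r :: "nat list"
    and P :: "'e::uniformly_complete_vector_lattice \<Rightarrow> 'y::real_vector"
    and T :: "'e list \<Rightarrow> 'y"
    and \<B> :: "'y set set"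
  assumes "p \<ge> 2" and "s \<ge> 2" and "p \<le> s"
    and "convex_bornology \<B>" and "separated_bornology \<B>"
    and "homogeneous_polynomial_with s P T"
    and "bounded_map P \<B>"
    and "length r = p" and "complete_partition s r"
  shows "orthogonally_additive P \<longleftrightarrow>
    (\<forall>fs. length fs = p \<and> (\<forall>f\<in>set fs. 0 \<le> f) \<longrightarrow>
      P (partitioned_geometric_mean s r fs) = T (concat (map2 replicate r fs)))"
proof
  have r: "\<forall>k<length r. 1 \<le> r ! k" "(\<Sum>k<length r. r ! k) = s"
    using assms(9) unfolding complete_partition_def by auto
  assume "orthogonally_additive P"
  then show "\<forall>fs. length fs = p \<and> (\<forall>f\<in>set fs. 0 \<le> f) \<longrightarrow>
      P (partitioned_geometric_mean s r fs) = T (concat (map2 replicate r fs))"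
    using partitioned_geometric_mean_formula[OF assms(2,4-7) _ _ r] assms(8) by simp
next
  assume formula: "\<forall>fs. length fs = p \<and> (\<forall>f\<in>set fs. 0 \<le> f) \<longrightarrow>
      P (partitioned_geometric_mean s r fs) = T (concat (map2 replicate r fs))"
  show "orthogonally_additive P"
  proof (rule orthogonally_additive_if_disjoint_zero[OF assms(6)])
    show "0 < s" using assms(2) by simp
    fix f g :: 'e and q
    assume "0 \<le> f" "0 \<le> g" "inf f g = 0" "0 < q" "q < s"
    then show "T (replicate q f @ replicate (s - q) g) = 0"
      using geometric_mean_formula_imp_disjoint_zero[OF assms(6,9)] formula assms(8) by simp
  qed
qed

end
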